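(* Let $P=\{x_a:a\in I\}\subset\mathbb{R}^d$ be a finite point set, let $\Omega=\operatorname{conv}(P)$, and let $h,\tau,\gamma,\varepsilon>0$. Suppose that $P$ is an $h$-covering of $\Omega$ and has $h$-density bounded by $\tau$, and let $\beta=\gamma/h^2$. Let $\{I,W,P\}$ be the LME approximation scheme with node set $P$ and parameter $\beta$, with shape functions $w_a^*$. Let $\Omega_{\varepsilon h}=\{x\in\mathbb{R}^d:\bar B(x,\varepsilon h)\subset\overline{\operatorname{conv}}(P)\}$. Let $u\in C^2(\bar\Omega)$. Then there exists a constant $C>0$, depending only on $\gamma,\tau,\varepsilon$ and $d$, such that $$\left|D^\alpha u_I(x)-D^\alpha u(x)\right|\le C\,\|D^2u\|_\infty\,h^{2-|\alpha|}$$ for all $x\in\Omega_{\varepsilon h}$ and all multiindices $\alpha$ with $|\alpha|\le 1$.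
   Context: $\overline{\operatorname{conv}}(P)$ is the closed convex hull of $P$ and $\operatorname{conv}(P)$ its interior; $\bar B(x,\delta)$ is the closed ball. Nodes are indexed one-to-one by $I$. $u_I(x)=\sum_{a\in I}u(x_a)w_a^*(x)$ and $\|D^2u\|_\infty=\max_{|\alpha|=2}\sup_{\bar\Omega}|D^\alpha u|$. The size of a bounded set is the diameter of the smallest ball containing it. A $d$-simplex is the convex hull of $d+1$ affinely independent points. $P$ is an $h$-covering of a set $A$ if for every $x\in A$ there is a $d$-simplex of size $<h$ with vertices in $P$ containing $x$. $P$ has $h$-density bounded by $\tau$ if $\#(P\cap\bar B(x,h))\le\tau$ for every $x\in\mathbb{R}^d$. LME (Local Maximum-Entropy) scheme with node set $P$ and parameter $\beta>0$: for each $x\in\overline{\operatorname{conv}}(P)$, $(w_a^*(x))_{a\in I}$ is the unique minimizer of $\sum_a w_a|x-x_a|^2+\frac1\beta\sum_a w_a\log w_a$ (with $0\log 0=0$) subject to $w_a\ge 0$, $\sum_a w_a=1$, $\sum_a w_ax_a=x$. Equivalently, for $x\in\operatorname{conv}(P)$, $$w_a^*(x)=\frac{e^{-\beta|x-x_a|^2+\langle\lambda^*(x),x-x_a\rangle}}{Z(x,\lambda^*(x))},\qquad Z(x,\lambda)=\sum_{a\in I}e^{-\beta|x-x_a|^2+\langle\lambda,x-x_a\rangle},$$ where $\lambda^*(x)\in\mathbb{R}^d$ is the minimizer of $\lambda\mapsto\log Z(x,\lambda)$. The functions $w_a^*$ are $C^\infty$ on $\operatorname{conv}(P)$. *)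

theory Defs
  imports "HOL-Analysis.Analysis"
begin

section \<open>Multiindices and partial derivatives\<close>

type_synonym 'n multiindex = "'n \<Rightarrow> nat"

definition mi_order :: "'n::finite multiindex \<Rightarrow> nat" where
  "mi_order \<alpha> = (\<Sum>i\<in>UNIV. \<alpha> i)"

definition partial_deriv :: "'n::finite \<Rightarrow> (real^'n \<Rightarrow> real) \<Rightarrow> real^'n \<Rightarrow> real" where
  "partial_deriv i f x = deriv (\<lambda>t. f (x + t *\<^sub>R axis i 1)) 0"

definition has_partial_deriv_at :: "'n::finite \<Rightarrow> (real^'n \<Rightarrow> real) \<Rightarrow> real^'n \<Rightarrow> bool" where
  "has_partial_deriv_at i f x \<longleftrightarrow> (\<lambda>t. f (x + t *\<^sub>R axis i 1)) field_differentiable (at 0)"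

text \<open>
  A fixed enumeration of the coordinates, which determines the order in which
  mixed partial derivatives are taken. For \<open>C\<^sup>k\<close> functions and multiindices of order
  at most \<open>k\<close> the choice is irrelevant.
\<close>

definition coords :: "'n::finite list" where
  "coords = (SOME xs. distinct xs \<and> set xs = UNIV)"

definition mi_deriv :: "'n::finite multiindex \<Rightarrow> (real^'n \<Rightarrow> real) \<Rightarrow> real^'n \<Rightarrow> real" where
  "mi_deriv \<alpha> f = foldr (\<lambda>i g. (partial_deriv i ^^ \<alpha> i) g) coords f"

lemma coords: "distinct (coords :: 'n::finite list)" "set (coords :: 'n list) = UNIV"
proof -
  have "\<exists>xs :: 'n list. distinct xs \<and> set xs = UNIV"
    using finite_distinct_list[OF finite_class.finite_UNIV] by blast
  from someI_ex[OF this]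
  show "distinct (coords :: 'n list)" "set (coords :: 'n list) = UNIV"
    unfolding coords_def by blast+
qed

lemma mi_deriv_zero: "mi_deriv (\<lambda>_. 0) f = f"
proof -
  have "foldr (\<lambda>i g. (partial_deriv i ^^ 0) g) xs f = f" for xs
    by (induction xs) auto
  then show ?thesis by (simp add: mi_deriv_def)
qed

lemma mi_deriv_unit: "mi_deriv (\<lambda>j. if j = i then 1 else 0) f = partial_deriv i f"
proof -
  have *: "distinct xs \<Longrightarrow>
      foldr (\<lambda>k g. (partial_deriv k ^^ (if k = i then 1 else 0)) g) xs f
        = (if i \<in> set xs then partial_deriv i f else f)" for xs
    by (induction xs) auto
  show ?thesis
    unfolding mi_deriv_def *[OF coords(1)] by (simp add: coords(2))
qed


section \<open>The space \<open>C\<^sup>k\<close> up to the boundary\<close>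

text \<open>
  For open \<open>S\<close>: all iterated partial derivatives of order at most \<open>k\<close> exist on \<open>S\<close>
  and extend continuously to the closure of \<open>S\<close>.
\<close>

primrec derivs_extend :: "nat \<Rightarrow> (real^'n::finite) set \<Rightarrow> (real^'n \<Rightarrow> real) \<Rightarrow> bool" where
  "derivs_extend 0 S f \<longleftrightarrow> (\<exists>g. continuous_on (closure S) g \<and> (\<forall>x\<in>S. g x = f x))"
| "derivs_extend (Suc k) S f \<longleftrightarrow>
     (\<exists>g. continuous_on (closure S) g \<and> (\<forall>x\<in>S. g x = f x)) \<and>
     (\<forall>i. (\<forall>x\<in>S. has_partial_deriv_at i f x) \<and> derivs_extend k S (partial_deriv i f))"

definition C_closure :: "nat \<Rightarrow> (real^'n::finite) set \<Rightarrow> (real^'n \<Rightarrow> real) \<Rightarrow> bool" where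
  "C_closure k S u \<longleftrightarrow> continuous_on (closure S) u \<and> derivs_extend k S u"

text \<open>On the closure of \<open>S\<close>, the derivative is understood as its continuous extension.\<close>

definition mi_deriv_ext ::
  "(real^'n::finite) set \<Rightarrow> 'n multiindex \<Rightarrow> (real^'n \<Rightarrow> real) \<Rightarrow> real^'n \<Rightarrow> real" where
  "mi_deriv_ext S \<alpha> u x = Lim (at x within S) (mi_deriv \<alpha> u)"

definition D2_norm :: "(real^'n::finite) set \<Rightarrow> (real^'n \<Rightarrow> real) \<Rightarrow> real" where
  "D2_norm S u =
     (MAX \<alpha>\<in>{\<alpha>. mi_order \<alpha> = 2}. SUP x\<in>closure S. \<bar>mi_deriv_ext S \<alpha> u x\<bar>)"


section \<open>Node sets\<close>

definition closed_conv :: "'a::euclidean_space set \<Rightarrow> 'a set" where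
  "closed_conv P = closure (convex hull P)"

definition open_conv :: "'a::euclidean_space set \<Rightarrow> 'a set" where
  "open_conv P = interior (closed_conv P)"

text \<open>Twice the radius of the smallest closed ball containing \<open>S\<close> (bounded, nonempty).\<close>

definition ball_size :: "'a::euclidean_space set \<Rightarrow> real" where
  "ball_size S = 2 * Inf {r. 0 \<le> r \<and> (\<exists>c. S \<subseteq> cball c r)}"

definition h_covering :: "real \<Rightarrow> 'a::euclidean_space set \<Rightarrow> 'a set \<Rightarrow> bool" where
  "h_covering h P A \<longleftrightarrow>
     (\<forall>x\<in>A. \<exists>V\<subseteq>P. card V = DIM('a) + 1 \<and> \<not> affine_dependent V \<and>
        ball_size (convex hull V) < h \<and> x \<in> convex hull V)"

definition h_density_bounded :: "real \<Rightarrow> real \<Rightarrow> 'a::euclidean_space set \<Rightarrow> bool" where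
  "h_density_bounded h \<tau> P \<longleftrightarrow> (\<forall>x. real (card (P \<inter> cball x h)) \<le> \<tau>)"

definition inner_region :: "real \<Rightarrow> 'a::euclidean_space set \<Rightarrow> 'a set" where
  "inner_region r P = {x. cball x r \<subseteq> closed_conv P}"


section \<open>Local maximum-entropy schemes\<close>

definition lme_feasible ::
  "'i set \<Rightarrow> ('i \<Rightarrow> 'a::euclidean_space) \<Rightarrow> 'a \<Rightarrow> ('i \<Rightarrow> real) \<Rightarrow> bool" where
  "lme_feasible I X x v \<longleftrightarrow>
     (\<forall>a\<in>I. 0 \<le> v a) \<and> (\<Sum>a\<in>I. v a) = 1 \<and> (\<Sum>a\<in>I. v a *\<^sub>R X a) = x"

text \<open>The convention \<open>0 log 0 = 0\<close> holds because of the factor \<open>v a\<close>.\<close>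

definition lme_objective ::
  "'i set \<Rightarrow> ('i \<Rightarrow> 'a::euclidean_space) \<Rightarrow> real \<Rightarrow> 'a \<Rightarrow> ('i \<Rightarrow> real) \<Rightarrow> real" where
  "lme_objective I X \<beta> x v =
     (\<Sum>a\<in>I. v a * (norm (x - X a))\<^sup>2) + 1 / \<beta> * (\<Sum>a\<in>I. v a * ln (v a))"

text \<open>
  The minimizer exists for every \<open>x\<close> in the closed convex hull and, by strict
  convexity of the objective, is unique on \<open>I\<close>; so this determines \<open>w a x\<close> for all
  \<open>a \<in> I\<close> and \<open>x\<close> in the closed convex hull.
\<close>

definition lme_scheme ::
  "'i set \<Rightarrow> ('i \<Rightarrow> 'a::euclidean_space) \<Rightarrow> real \<Rightarrow> ('i \<Rightarrow> 'a \<Rightarrow> real) \<Rightarrow> bool" where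
  "lme_scheme I X \<beta> w \<longleftrightarrow>
     (\<forall>x\<in>closed_conv (X ` I).
        is_arg_min (lme_objective I X \<beta> x) (lme_feasible I X x) (\<lambda>a. w a x))"

definition approximant ::
  "'i set \<Rightarrow> ('i \<Rightarrow> 'a::euclidean_space) \<Rightarrow> ('i \<Rightarrow> 'a \<Rightarrow> real) \<Rightarrow> ('a \<Rightarrow> real) \<Rightarrow> 'a \<Rightarrow> real" where
  "approximant I X w u x = (\<Sum>a\<in>I. u (X a) * w a x)"

end

theory Submission
  imports Defs
begin

text \<open>
  Write \<open>r\<^sub>a = x\<^sub>a - x\<close> and \<open>\<beta> = \<gamma> / h\<^sup>2\<close>. At an interior point \<open>x\<close> the weights are
  \<open>w\<^sub>a = exp (-\<beta> \<bar>r\<^sub>a\<bar>\<^sup>2 + \<langle>\<theta>, r\<^sub>a\<rangle>) / Z(\<theta>)\<close>, where \<open>\<theta>\<close> is determined by \<open>\<Sum>\<^sub>a w\<^sub>a r\<^sub>a = 0\<close>. In the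
  natural parameter of this exponential family the derivative of the mean is the covariance
  \<open>J = \<Sum>\<^sub>a w\<^sub>a r\<^sub>a r\<^sub>a\<^sup>T\<close>, so the inverse function theorem gives
  \<open>\<partial>\<^sub>v w\<^sub>a = w\<^sub>a \<langle>J\<^sup>-\<^sup>1 v, r\<^sub>a\<rangle>\<close>.

  Let \<open>e\<^sub>a\<close> be the remainder at \<open>x\<^sub>a\<close> of the first-order Taylor polynomial of \<open>u\<close> at \<open>x\<close>; then
  \<open>\<bar>e\<^sub>a\<bar>\<close> is at most a multiple of \<open>\<parallel>D\<^sup>2u\<parallel> \<bar>r\<^sub>a\<bar>\<^sup>2\<close>. As affine functions are reproduced, the errors of
  \<open>u\<^sub>I\<close> and of \<open>\<partial>\<^sub>v u\<^sub>I\<close> are \<open>\<Sum>\<^sub>a w\<^sub>a e\<^sub>a\<close> and \<open>\<Sum>\<^sub>a w\<^sub>a \<langle>J\<^sup>-\<^sup>1 v, r\<^sub>a\<rangle> e\<^sub>a\<close>. It remains to bound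
  \<open>\<Sum>\<^sub>a w\<^sub>a \<bar>r\<^sub>a\<bar>\<^sup>k\<close> by a multiple of \<open>h\<^sup>k\<close>, and \<open>J\<close> from below by a multiple of \<open>h\<^sup>2\<close>. Both follow once
  \<open>h \<bar>\<theta>\<bar>\<close> is bounded. By the density bound, \<open>Z(\<theta>) \<le> Z(0)\<close> is bounded; by the covering, some node
  at distance at most \<open>(1 + \<epsilon>) h\<close> from \<open>x\<close> satisfies \<open>\<langle>\<theta>, r\<^sub>a\<rangle> \<ge> \<epsilon> h \<bar>\<theta>\<bar> / 2\<close>, so that
  \<open>Z(\<theta>) \<ge> exp (-\<gamma> (1 + \<epsilon>)\<^sup>2 + \<epsilon> h \<bar>\<theta>\<bar> / 2)\<close>.
\<close>

section \<open>Taylor's formula and second partial derivatives\<close>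

lemma has_partial_deriv_line:
  assumes "has_partial_deriv_at i f (y + s *\<^sub>R axis i 1)"
  shows "((\<lambda>t. f (y + t *\<^sub>R axis i 1)) has_real_derivative
           partial_deriv i f (y + s *\<^sub>R axis i 1)) (at s)"
proof -
  have "((\<lambda>t. f ((y + s *\<^sub>R axis i 1) + t *\<^sub>R axis i 1)) has_real_derivative
           partial_deriv i f (y + s *\<^sub>R axis i 1)) (at 0)"
    using assms unfolding has_partial_deriv_at_def partial_deriv_def
    by (rule field_differentiable_derivI)
  moreover have "(\<lambda>t. f ((y + s *\<^sub>R axis i 1) + t *\<^sub>R axis i 1)) =
      (\<lambda>t. (\<lambda>r. f (y + r *\<^sub>R axis i 1)) (t + s))"
    by (simp add: algebra_simps)
  ultimately show ?thesis
    using DERIV_shift[of "\<lambda>r. f (y + r *\<^sub>R axis i 1)" _ 0 s] by simp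
qed

lemma partial_deriv_mvt:
  assumes "\<And>r. \<bar>r\<bar> \<le> \<bar>t\<bar> \<Longrightarrow> has_partial_deriv_at i f (y + r *\<^sub>R axis i 1)"
  obtains s where "\<bar>s\<bar> \<le> \<bar>t\<bar>"
    "f (y + t *\<^sub>R axis i 1) - f y = t * partial_deriv i f (y + s *\<^sub>R axis i 1)"
proof -
  have "\<exists>z>0. z < 1 \<and> f (y + (t * 1) *\<^sub>R axis i 1) - f (y + (t * 0) *\<^sub>R axis i 1) =
      (1 - 0) * (t * partial_deriv i f (y + (t * z) *\<^sub>R axis i 1))"
  proof (rule MVT2)
    fix r :: real assume "0 \<le> r" "r \<le> 1"
    then have "\<bar>t * r\<bar> \<le> \<bar>t\<bar>"
      by (simp add: abs_mult mult_left_le)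
    from has_partial_deriv_line[OF assms[OF this]]
    have "((\<lambda>r. f (y + r *\<^sub>R axis i 1)) has_real_derivative
        partial_deriv i f (y + (t * r) *\<^sub>R axis i 1)) (at (t * r))" .
    then have "((\<lambda>r. f (y + (t * r) *\<^sub>R axis i 1)) has_real_derivative
        partial_deriv i f (y + (t * r) *\<^sub>R axis i 1) * t) (at r)"
      by (rule DERIV_chain2) (auto intro!: derivative_eq_intros)
    then show "((\<lambda>r. f (y + (t * r) *\<^sub>R axis i 1)) has_real_derivative
        t * partial_deriv i f (y + (t * r) *\<^sub>R axis i 1)) (at r)"
      by (simp add: mult.commute)
  qed simp
  then obtain z where z: "0 < z" "z < 1"
    "f (y + t *\<^sub>R axis i 1) - f y = t * partial_deriv i f (y + (t * z) *\<^sub>R axis i 1)"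
    by auto
  moreover have "\<bar>t * z\<bar> \<le> \<bar>t\<bar>"
    using z by (simp add: abs_mult mult_left_le)
  ultimately show ?thesis
    using that by blast
qed

text \<open>Phrased through coordinate lines only, the form in which \<open>derivs_extend\<close>
  supplies it; total differentiability on open sets is derived in
  \<open>C1_on_has_derivative\<close>.\<close>

definition C1_on :: "(real^'n::finite) set \<Rightarrow> (real^'n \<Rightarrow> real) \<Rightarrow> bool" where
  "C1_on S f \<longleftrightarrow>
     (\<forall>i. (\<forall>x\<in>S. has_partial_deriv_at i f x) \<and> continuous_on S (partial_deriv i f))"

text \<open>The point is moved one coordinate at a time, each move costing one mean value theorem.
  Every intermediate displacement is dominated componentwise by \<open>v\<close>, so it stays in the
  ball.\<close>

lemma C1_on_increment_bound:
  fixes f :: "real^'n::finite \<Rightarrow> real"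
  assumes pd: "\<And>i y. y \<in> ball x d \<Longrightarrow> has_partial_deriv_at i f y"
    and close: "\<And>i y. y \<in> ball x d \<Longrightarrow> \<bar>partial_deriv i f y - partial_deriv i f x\<bar> \<le> e"
    and "norm v < d" and "finite A"
  shows "\<bar>f (x + (\<Sum>i\<in>A. (v $ i) *\<^sub>R axis i 1)) - f x - (\<Sum>i\<in>A. v $ i * partial_deriv i f x)\<bar>
           \<le> e * (\<Sum>i\<in>A. \<bar>v $ i\<bar>)"
  using \<open>finite A\<close>
proof (induction A rule: finite_induct)
  case (insert k A)
  define p where "p = (\<Sum>i\<in>A. (v $ i) *\<^sub>R axis i (1::real))"
  have pj: "p $ j = (if j \<in> A then v $ j else 0)" for j
    using \<open>finite A\<close> by (simp add: p_def axis_def if_distrib sum.delta' cong: if_cong)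
  have inball: "x + p + r *\<^sub>R axis k 1 \<in> ball x d" if "\<bar>r\<bar> \<le> \<bar>v $ k\<bar>" for r
  proof -
    have "norm (p + r *\<^sub>R axis k 1) \<le> norm v"
      using that insert.hyps
      by (intro norm_le_componentwise_cart) (auto simp: pj axis_def)
    then show ?thesis
      using \<open>norm v < d\<close> norm_minus_cancel[of "p + r *\<^sub>R axis k 1"]
      by (simp add: dist_norm)
  qed
  obtain s where s: "\<bar>s\<bar> \<le> \<bar>v $ k\<bar>"
    "f (x + p + (v $ k) *\<^sub>R axis k 1) - f (x + p) = v $ k * partial_deriv k f (x + p + s *\<^sub>R axis k 1)"
    using partial_deriv_mvt[of "v $ k" k f "x + p"] pd inball by metis
  have "\<bar>v $ k * partial_deriv k f (x + p + s *\<^sub>R axis k 1) - v $ k * partial_deriv k f x\<bar> \<le> e * \<bar>v $ k\<bar>"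
    using mult_right_mono[OF close[OF inball[OF s(1)], of k], of "\<bar>v $ k\<bar>"]
    by (simp add: abs_mult mult.commute flip: right_diff_distrib)
  moreover have "\<bar>f (x + p) - f x - (\<Sum>i\<in>A. v $ i * partial_deriv i f x)\<bar> \<le> e * (\<Sum>i\<in>A. \<bar>v $ i\<bar>)"
    using insert.IH by (simp add: p_def)
  ultimately have "\<bar>f (x + p + (v $ k) *\<^sub>R axis k 1) - f x
      - (v $ k * partial_deriv k f x + (\<Sum>i\<in>A. v $ i * partial_deriv i f x))\<bar>
      \<le> e * (\<bar>v $ k\<bar> + (\<Sum>i\<in>A. \<bar>v $ i\<bar>))"
    using s(2) unfolding distrib_left by linarith
  then show ?case
    using insert.hyps by (simp add: p_def algebra_simps)
qed simp

lemma C1_on_has_derivative: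
  fixes f :: "real^'n::finite \<Rightarrow> real"
  assumes "C1_on S f" "open S" "x \<in> S"
  shows "(f has_derivative (\<lambda>v. \<Sum>i\<in>UNIV. v $ i * partial_deriv i f x)) (at x)"
  unfolding has_derivative_at_alt
proof (intro conjI allI impI)
  show "bounded_linear (\<lambda>v. \<Sum>i\<in>UNIV. v $ i * partial_deriv i f x)"
    by (intro bounded_linear_sum bounded_linear_mult_const bounded_linear_vec_nth)
  fix e :: real assume "e > 0"
  \<comment> \<open>The l1 norm of the increment is at most \<open>CARD('n)\<close> times its
    Euclidean norm.\<close>
  define e' where "e' = e / CARD('n)"
  have "e' > 0" using \<open>e > 0\<close> by (simp add: e'_def)
  have "\<forall>\<^sub>F y in at x. \<forall>i. \<bar>partial_deriv i f y - partial_deriv i f x\<bar> < e'"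
  proof (rule eventually_all_finite)
    fix i
    have "(partial_deriv i f \<longlongrightarrow> partial_deriv i f x) (at x)"
      using assms unfolding C1_on_def
      by (metis continuous_on_eq_continuous_at continuous_at)
    then show "\<forall>\<^sub>F y in at x. \<bar>partial_deriv i f y - partial_deriv i f x\<bar> < e'"
      using \<open>e' > 0\<close> by (auto simp: tendsto_iff dist_real_def)
  qed
  then obtain d1 where d1: "d1 > 0"
    "\<And>y i. y \<noteq> x \<Longrightarrow> dist y x < d1 \<Longrightarrow> \<bar>partial_deriv i f y - partial_deriv i f x\<bar> < e'"
    unfolding eventually_at by auto
  obtain d2 where d2: "d2 > 0" "ball x d2 \<subseteq> S"
    using assms open_contains_ball by blast
  define d where "d = min d1 d2"
  have "\<bar>f y - f x - (\<Sum>i\<in>UNIV. (y - x) $ i * partial_deriv i f x)\<bar> \<le> e * norm (y - x)"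
    if "norm (y - x) < d" for y
  proof -
    have "\<bar>f (x + (\<Sum>i\<in>UNIV. ((y - x) $ i) *\<^sub>R axis i 1)) - f x
        - (\<Sum>i\<in>UNIV. (y - x) $ i * partial_deriv i f x)\<bar> \<le> e' * (\<Sum>i\<in>UNIV. \<bar>(y - x) $ i\<bar>)"
    proof (rule C1_on_increment_bound[where d = d])
      fix i z assume z: "z \<in> ball x d"
      then show "has_partial_deriv_at i f z"
        using assms d2 by (auto simp: C1_on_def d_def)
      show "\<bar>partial_deriv i f z - partial_deriv i f x\<bar> \<le> e'"
        using d1(2)[of z i] z \<open>e' > 0\<close> by (cases "z = x") (auto simp: d_def dist_commute)
    qed (use that in auto)
    also have "(\<Sum>i\<in>UNIV. ((y - x) $ i) *\<^sub>R axis i 1) = y - x"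
      using basis_expansion[of "y - x"] by (simp add: scalar_mult_eq_scaleR)
    also have "e' * (\<Sum>i\<in>UNIV. \<bar>(y - x) $ i\<bar>) \<le> e' * (\<Sum>i\<in>(UNIV::'n set). norm (y - x))"
      using \<open>e' > 0\<close> by (intro mult_left_mono sum_mono component_le_norm_cart) auto
    also have "\<dots> = e * norm (y - x)" by (simp add: e'_def)
    finally show ?thesis by simp
  qed
  then show "\<exists>d>0. \<forall>y. norm (y - x) < d \<longrightarrow>
      norm (f y - f x - (\<Sum>i\<in>UNIV. (y - x) $ i * partial_deriv i f x)) \<le> e * norm (y - x)"
    using d1 d2 by (intro exI[of _ d]) (auto simp: d_def)
qed

text \<open>The mean value theorem is applied first in direction \<open>i\<close>, then in direction
  \<open>j\<close>. The second difference is symmetric in \<open>i\<close> and \<open>j\<close>, so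
  the two orders of differentiation become comparable.\<close>

lemma mixed_difference_eq:
  fixes f :: "real^'n::finite \<Rightarrow> real"
  assumes "ball x d \<subseteq> S" "0 < t" "2 * t < d"
    and pd: "\<And>y. y \<in> S \<Longrightarrow> has_partial_deriv_at i f y"
    and pd2: "\<And>y. y \<in> S \<Longrightarrow> has_partial_deriv_at j (partial_deriv i f) y"
  obtains p where "p \<in> cball x (2 * t)"
    "f (x + t *\<^sub>R axis i 1 + t *\<^sub>R axis j 1) - f (x + t *\<^sub>R axis i 1)
       - f (x + t *\<^sub>R axis j 1) + f x = t\<^sup>2 * partial_deriv j (partial_deriv i f) p"
proof -
  have inb: "x + r *\<^sub>R axis i 1 + s *\<^sub>R axis j 1 \<in> cball x (2 * t)" if "\<bar>r\<bar> \<le> t" "\<bar>s\<bar> \<le> t" for r s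
  proof -
    have "norm (r *\<^sub>R axis i (1::real) + s *\<^sub>R axis j 1) \<le> \<bar>r\<bar> + \<bar>s\<bar>"
      by (rule norm_triangle_le) (simp add: norm_axis_1)
    with that show ?thesis
      using norm_minus_cancel[of "r *\<^sub>R axis i (1::real) + s *\<^sub>R axis j 1"]
      by (simp add: dist_norm)
  qed
  have inS: "x + r *\<^sub>R axis i 1 + s *\<^sub>R axis j 1 \<in> S" if "\<bar>r\<bar> \<le> t" "\<bar>s\<bar> \<le> t" for r s
    using inb[OF that] assms(1,3) by (auto simp: subset_iff)
  define G where "G r = f (x + t *\<^sub>R axis j 1 + r *\<^sub>R axis i 1) - f (x + r *\<^sub>R axis i 1)" for r
  have "\<exists>z>0. z < t \<and> G t - G 0 = (t - 0) *
     (partial_deriv i f (x + t *\<^sub>R axis j 1 + z *\<^sub>R axis i 1) - partial_deriv i f (x + z *\<^sub>R axis i 1))"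
  proof (rule MVT2)
    fix r :: real assume r: "0 \<le> r" "r \<le> t"
    show "(G has_real_derivative (partial_deriv i f (x + t *\<^sub>R axis j 1 + r *\<^sub>R axis i 1)
        - partial_deriv i f (x + r *\<^sub>R axis i 1))) (at r)"
      unfolding G_def using inS[of r t] inS[of r 0] r
      by (intro derivative_intros has_partial_deriv_line pd) (auto simp: add_ac)
  qed (use assms in auto)
  then obtain z where z: "0 < z" "z < t" and Gz: "G t - G 0 = t *
     (partial_deriv i f (x + z *\<^sub>R axis i 1 + t *\<^sub>R axis j 1) - partial_deriv i f (x + z *\<^sub>R axis i 1))"
    by (auto simp: add_ac)
  obtain s where s: "\<bar>s\<bar> \<le> \<bar>t\<bar>"
    "partial_deriv i f (x + z *\<^sub>R axis i 1 + t *\<^sub>R axis j 1) - partial_deriv i f (x + z *\<^sub>R axis i 1)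
      = t * partial_deriv j (partial_deriv i f) (x + z *\<^sub>R axis i 1 + s *\<^sub>R axis j 1)"
  proof (rule partial_deriv_mvt[of t j "partial_deriv i f" "x + z *\<^sub>R axis i 1"])
    show "has_partial_deriv_at j (partial_deriv i f) (x + z *\<^sub>R axis i 1 + r *\<^sub>R axis j 1)"
      if "\<bar>r\<bar> \<le> \<bar>t\<bar>" for r
      using z that by (intro pd2 inS) auto
  qed
  show ?thesis
  proof (rule that)
    show "x + z *\<^sub>R axis i 1 + s *\<^sub>R axis j 1 \<in> cball x (2 * t)"
      using inb[of z s] z s by auto
    show "f (x + t *\<^sub>R axis i 1 + t *\<^sub>R axis j 1) - f (x + t *\<^sub>R axis i 1)
       - f (x + t *\<^sub>R axis j 1) + f x
       = t\<^sup>2 * partial_deriv j (partial_deriv i f) (x + z *\<^sub>R axis i 1 + s *\<^sub>R axis j 1)"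
      using Gz s(2) by (simp add: G_def power2_eq_square add_ac)
  qed
qed

text \<open>The same second difference is \<open>t\<^sup>2\<close> times either mixed derivative at
  some point near \<open>x\<close>; continuity carries the equality to \<open>x\<close>. This is
  needed because \<open>mi_deriv\<close> differentiates in the fixed order of
  \<open>coords\<close>.\<close>

lemma partial_deriv_commute:
  fixes f :: "real^'n::finite \<Rightarrow> real"
  assumes "open S" "x \<in> S" "C1_on S f" "\<And>k. C1_on S (partial_deriv k f)"
  shows "partial_deriv j (partial_deriv i f) x = partial_deriv i (partial_deriv j f) x"
proof (rule ccontr)
  let ?A = "partial_deriv j (partial_deriv i f)" and ?B = "partial_deriv i (partial_deriv j f)"
  assume ne: "?A x \<noteq> ?B x"
  define e where "e = \<bar>?A x - ?B x\<bar> / 2"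
  have "e > 0" using ne by (simp add: e_def)
  have cont: "continuous (at x) ?A" "continuous (at x) ?B"
    using assms by (auto simp: C1_on_def continuous_on_eq_continuous_at)
  obtain d1 where d1: "d1 > 0" "\<And>y. dist y x < d1 \<Longrightarrow> \<bar>?A y - ?A x\<bar> < e"
    using cont(1) \<open>e > 0\<close> unfolding continuous_at_eps_delta dist_real_def by blast
  obtain d2 where d2: "d2 > 0" "\<And>y. dist y x < d2 \<Longrightarrow> \<bar>?B y - ?B x\<bar> < e"
    using cont(2) \<open>e > 0\<close> unfolding continuous_at_eps_delta dist_real_def by blast
  obtain d3 where d3: "d3 > 0" "ball x d3 \<subseteq> S"
    using assms open_contains_ball by blast
  define t where "t = Min {d1, d2, d3} / 3"
  have t: "0 < t" "2 * t < d1" "2 * t < d2" "2 * t < d3"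
    using d1 d2 d3 by (auto simp: t_def)
  obtain p where p: "p \<in> cball x (2 * t)"
    "f (x + t *\<^sub>R axis i 1 + t *\<^sub>R axis j 1) - f (x + t *\<^sub>R axis i 1)
       - f (x + t *\<^sub>R axis j 1) + f x = t\<^sup>2 * ?A p"
    using mixed_difference_eq[OF d3(2) t(1,4), of i f j] assms by (auto simp: C1_on_def)
  obtain q where q: "q \<in> cball x (2 * t)"
    "f (x + t *\<^sub>R axis j 1 + t *\<^sub>R axis i 1) - f (x + t *\<^sub>R axis j 1)
       - f (x + t *\<^sub>R axis i 1) + f x = t\<^sup>2 * ?B q"
    using mixed_difference_eq[OF d3(2) t(1,4), of j f i] assms by (auto simp: C1_on_def)
  have "t\<^sup>2 * ?A p = t\<^sup>2 * ?B q"
    using p(2) q(2) by (simp only: add.assoc add.commute[of "t *\<^sub>R axis j 1"])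
  then have "?A p = ?B q" using t by simp
  moreover have "\<bar>?A p - ?A x\<bar> < e" "\<bar>?B q - ?B x\<bar> < e"
    using p q t d1 d2 by (auto simp: dist_commute)
  ultimately show False
    unfolding e_def by argo
qed

lemma C1_on_has_derivative_line:
  fixes f :: "real^'n::finite \<Rightarrow> real"
  assumes "C1_on S f" "open S" "x + t *\<^sub>R v \<in> S"
  shows "((\<lambda>t. f (x + t *\<^sub>R v)) has_real_derivative
           (\<Sum>i\<in>UNIV. v $ i * partial_deriv i f (x + t *\<^sub>R v))) (at t)"
proof -
  have "((\<lambda>t. x + t *\<^sub>R v) has_derivative (\<lambda>t. t *\<^sub>R v)) (at t)"
    by (auto intro!: derivative_eq_intros)
  from has_derivative_compose[OF this C1_on_has_derivative[OF assms]]
  show ?thesis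
    by (auto simp: has_field_derivative_def sum_distrib_left mult_ac elim!: has_derivative_eq_rhs)
qed

lemma abs_sum_component_mult_le:
  fixes v :: "real^'n::finite"
  assumes "\<And>i. \<bar>c i\<bar> \<le> B"
  shows "\<bar>\<Sum>i\<in>UNIV. v $ i * c i\<bar> \<le> CARD('n) * (norm v * B)"
proof -
  have "\<bar>\<Sum>i\<in>UNIV. v $ i * c i\<bar> \<le> (\<Sum>i\<in>UNIV. \<bar>v $ i * c i\<bar>)"
    by (rule sum_abs)
  also have "\<dots> \<le> (\<Sum>i\<in>(UNIV::'n set). norm v * B)"
    unfolding abs_mult
    by (intro sum_mono mult_mono component_le_norm_cart assms) auto
  finally show ?thesis by simp
qed

text \<open>Nodes may lie on the boundary, so \<open>z\<close> is only in the closure and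
  \<open>f\<close> only continuous there. The mean value theorem tolerates this: it is applied to
  \<open>f\<close> minus its linear part along the segment, then to each partial derivative up to
  the intermediate point. Each coordinate sum costs a factor \<open>CARD('n)\<close>.\<close>

lemma taylor_second_order_bound:
  fixes f :: "real^'n::finite \<Rightarrow> real" and M :: real
  assumes "open S" "x \<in> S" "open_segment x z \<subseteq> S" "z \<in> closure S"
    and cont: "continuous_on (closure S) f"
    and C1: "C1_on S f" and C2: "\<And>i. C1_on S (partial_deriv i f)"
    and M: "\<And>i j y. y \<in> S \<Longrightarrow> \<bar>partial_deriv j (partial_deriv i f) y\<bar> \<le> M"
  shows "\<bar>f z - f x - (\<Sum>i\<in>UNIV. (z - x) $ i * partial_deriv i f x)\<bar>
           \<le> (CARD('n))\<^sup>2 * M * (norm (z - x))\<^sup>2"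
proof (cases "z = x")
  case False
  define v where "v = z - x"
  have inS: "x + t *\<^sub>R v \<in> S" if "0 \<le> t" "t < 1" for t
  proof (cases "t = 0")
    case False
    then have "x + t *\<^sub>R v \<in> open_segment x z"
      using that \<open>z \<noteq> x\<close> by (auto simp: in_segment v_def algebra_simps intro!: exI[of _ t])
    then show ?thesis using assms(3) by blast
  qed (use assms in simp)
  have inCl: "x + t *\<^sub>R v \<in> closure S" if "0 \<le> t" "t \<le> 1" for t
  proof (cases "t = 1")
    case False
    then show ?thesis using inS[of t] that closure_subset by auto
  qed (use assms in \<open>simp add: v_def\<close>)
  define D where "D g y = (\<Sum>i\<in>UNIV. v $ i * partial_deriv i g y)" for g :: "real^'n \<Rightarrow> real" and y
  define G where "G t = f (x + t *\<^sub>R v) - t * D f x" for t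
  have "continuous_on {0..1} (\<lambda>t. f (x + t *\<^sub>R v))"
    using inCl by (intro continuous_on_compose2[OF cont] continuous_intros) auto
  then have "continuous_on {0..1} G"
    unfolding G_def by (intro continuous_intros)
  moreover have G': "(G has_real_derivative (D f (x + t *\<^sub>R v) - D f x)) (at t)" if "0 < t" "t < 1" for t
    unfolding G_def D_def using that
    by (auto intro!: derivative_eq_intros C1_on_has_derivative_line[OF C1 \<open>open S\<close>] inS)
  ultimately obtain l \<xi> where \<xi>: "0 < \<xi>" "\<xi> < 1" "(G has_real_derivative l) (at \<xi>)" "G 1 - G 0 = (1 - 0) * l"
    using MVT[of 0 1 G] real_differentiable_def by auto
  have l: "l = D f (x + \<xi> *\<^sub>R v) - D f x"
    using DERIV_unique[OF \<xi>(3) G'] \<xi> by blast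
  have "\<bar>partial_deriv i f (x + \<xi> *\<^sub>R v) - partial_deriv i f x\<bar> \<le> CARD('n) * (norm v * M)" for i
  proof -
    have "\<exists>\<eta>>0. \<eta> < \<xi> \<and> partial_deriv i f (x + \<xi> *\<^sub>R v) - partial_deriv i f (x + 0 *\<^sub>R v)
        = (\<xi> - 0) * D (partial_deriv i f) (x + \<eta> *\<^sub>R v)"
      unfolding D_def using \<xi>
      by (intro MVT2 C1_on_has_derivative_line[OF C2 \<open>open S\<close>] inS) auto
    then obtain \<eta> where \<eta>: "0 < \<eta>" "\<eta> < \<xi>" "partial_deriv i f (x + \<xi> *\<^sub>R v) - partial_deriv i f x
        = \<xi> * D (partial_deriv i f) (x + \<eta> *\<^sub>R v)"
      by auto
    have "\<bar>D (partial_deriv i f) (x + \<eta> *\<^sub>R v)\<bar> \<le> CARD('n) * (norm v * M)"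
      unfolding D_def using \<eta> \<xi> by (intro abs_sum_component_mult_le M inS) auto
    moreover have "\<bar>\<xi> * D (partial_deriv i f) (x + \<eta> *\<^sub>R v)\<bar> \<le> 1 * \<bar>D (partial_deriv i f) (x + \<eta> *\<^sub>R v)\<bar>"
      unfolding abs_mult using \<xi> by (intro mult_right_mono) auto
    ultimately show ?thesis unfolding \<eta>(3) by linarith
  qed
  then have "\<bar>\<Sum>i\<in>UNIV. v $ i * (partial_deriv i f (x + \<xi> *\<^sub>R v) - partial_deriv i f x)\<bar>
      \<le> CARD('n) * (norm v * (CARD('n) * (norm v * M)))"
    by (rule abs_sum_component_mult_le)
  then have "\<bar>l\<bar> \<le> CARD('n) * (norm v * (CARD('n) * (norm v * M)))"
    by (simp add: l D_def right_diff_distrib sum_subtractf)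
  moreover have "G 1 - G 0 = f z - f x - D f x"
    by (simp add: G_def v_def)
  ultimately have "\<bar>f z - f x - D f x\<bar> \<le> CARD('n) * (norm v * (CARD('n) * (norm v * M)))"
    using \<xi>(4) by simp
  then show ?thesis
    by (simp add: D_def v_def power2_eq_square mult_ac)
qed simp

section \<open>Functions that are C^2 up to the boundary, and the norm of their second
  derivatives\<close>

lemma derivs_extend_imp_continuous_extension:
  "derivs_extend k S f \<Longrightarrow> \<exists>g. continuous_on (closure S) g \<and> (\<forall>x\<in>S. g x = f x)"
  by (cases k) auto

lemma derivs_extend_imp_continuous_on:
  assumes "derivs_extend k S f"
  shows "continuous_on S f"
proof -
  obtain g where "continuous_on (closure S) g" "\<forall>x\<in>S. g x = f x"
    using derivs_extend_imp_continuous_extension[OF assms] by blast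
  then show ?thesis
    by (metis closure_subset continuous_on_cong continuous_on_subset)
qed

lemma derivs_extend_imp_C1_on: "derivs_extend (Suc k) S f \<Longrightarrow> C1_on S f"
  by (auto simp: C1_on_def intro: derivs_extend_imp_continuous_on)

lemma derivs_extend_2D:
  assumes "derivs_extend 2 S f"
  shows "C1_on S f" "C1_on S (partial_deriv i f)"
    "\<exists>g. continuous_on (closure S) g \<and> (\<forall>x\<in>S. g x = partial_deriv j (partial_deriv i f) x)"
proof -
  have 2: "derivs_extend (Suc (Suc 0)) S f"
    using assms by (simp add: numeral_2_eq_2)
  then have 1: "derivs_extend (Suc 0) S (partial_deriv i f)" by auto
  show "C1_on S f" "C1_on S (partial_deriv i f)"
    using 1 2 derivs_extend_imp_C1_on by blast+
  show "\<exists>g. continuous_on (closure S) g \<and> (\<forall>x\<in>S. g x = partial_deriv j (partial_deriv i f) x)"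
    using 1 by auto
qed

text \<open>The order that occurs depends on the unspecified enumeration \<open>coords\<close>,
  hence the disjunction. For \<open>i = j\<close> the two indicators in \<open>\<alpha>\<close> add
  up to 2.\<close>

lemma mi_deriv_two:
  fixes f :: "real^'n::finite \<Rightarrow> real"
  obtains \<alpha> where "mi_order \<alpha> = 2"
    "mi_deriv \<alpha> f = partial_deriv i (partial_deriv j f) \<or> mi_deriv \<alpha> f = partial_deriv j (partial_deriv i f)"
proof -
  define \<alpha> :: "'n multiindex" where "\<alpha> = (\<lambda>k. (if k = i then 1 else 0) + (if k = j then 1 else 0))"
  define F where "F xs = foldr (\<lambda>k g. (partial_deriv k ^^ \<alpha> k) g) xs f" for xs
  have "mi_order \<alpha> = 2"
    by (simp add: mi_order_def \<alpha>_def sum.distrib)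
  moreover have
    "(i \<notin> set xs \<longrightarrow> j \<notin> set xs \<longrightarrow> F xs = f) \<and>
     (i \<in> set xs \<longrightarrow> j \<notin> set xs \<longrightarrow> F xs = partial_deriv i f) \<and>
     (i \<notin> set xs \<longrightarrow> j \<in> set xs \<longrightarrow> F xs = partial_deriv j f) \<and>
     (i \<in> set xs \<longrightarrow> j \<in> set xs \<longrightarrow>
        F xs = partial_deriv i (partial_deriv j f) \<or> F xs = partial_deriv j (partial_deriv i f))"
    if "distinct xs" for xs
    using that by (induction xs) (auto simp: F_def \<alpha>_def)
  then have "F coords = partial_deriv i (partial_deriv j f) \<or> F coords = partial_deriv j (partial_deriv i f)"
    using coords[where 'n = 'n] by blast
  ultimately show ?thesis
    using that unfolding mi_deriv_def F_def by blast
qed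

lemma finite_mi_order: "finite {\<alpha> :: 'n::finite multiindex. mi_order \<alpha> = k}"
proof (rule finite_subset)
  show "{\<alpha> :: 'n multiindex. mi_order \<alpha> = k} \<subseteq> UNIV \<rightarrow>\<^sub>E {..k}"
  proof
    fix \<alpha> :: "'n multiindex" assume "\<alpha> \<in> {\<alpha>. mi_order \<alpha> = k}"
    then have "\<alpha> i \<le> k" for i
      using member_le_sum[of i UNIV \<alpha>] by (simp add: mi_order_def)
    then show "\<alpha> \<in> UNIV \<rightarrow>\<^sub>E {..k}" by auto
  qed
  show "finite ((UNIV :: 'n set) \<rightarrow>\<^sub>E {..k})"
    by (intro finite_PiE) auto
qed

text \<open>Every point of the closure of an open set is a limit point of it, so the limit used in
  \<open>mi_deriv_ext\<close> is unique.\<close>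

lemma Lim_within_eq_extension:
  fixes f g :: "real^'n::finite \<Rightarrow> real"
  assumes "open S" "continuous_on (closure S) g" "\<And>x. x \<in> S \<Longrightarrow> g x = f x" "y \<in> closure S"
  shows "Lim (at y within S) f = g y"
proof (rule tendsto_Lim)
  have "y islimpt S"
    using assms(1,4) interior_limit_point[of y S] by (auto simp: closure_def interior_open)
  then show "\<not> trivial_limit (at y within S)"
    by (simp add: trivial_limit_within)
  have "(g \<longlongrightarrow> g y) (at y within S)"
    using assms(2,4) closure_subset by (auto simp: continuous_on_def intro: tendsto_within_subset)
  then show "(f \<longlongrightarrow> g y) (at y within S)"
    by (rule Lim_transform_eventually) (auto simp: eventually_at_filter assms(3))
qed

text \<open>\<open>MAX\<close> and \<open>SUP\<close> give upper bounds only once finiteness and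
  boundedness are known: there are finitely many multiindices of order 2, and the continuous
  extension is bounded on the compact closure. Symmetry covers the order of differentiation that
  \<open>mi_deriv\<close> does not use.\<close>

lemma second_partial_le_D2_norm:
  fixes u :: "real^'n::finite \<Rightarrow> real"
  assumes "open S" "bounded S" "C_closure 2 S u" "x \<in> S"
  shows "\<bar>partial_deriv j (partial_deriv i u) x\<bar> \<le> D2_norm S u"
proof -
  have ext: "derivs_extend 2 S u"
    using assms by (simp add: C_closure_def)
  note C2 = derivs_extend_2D[OF ext]
  obtain \<alpha> where \<alpha>: "mi_order \<alpha> = 2"
    "mi_deriv \<alpha> u = partial_deriv i (partial_deriv j u) \<or> mi_deriv \<alpha> u = partial_deriv j (partial_deriv i u)"
    by (rule mi_deriv_two)
  obtain g where g: "continuous_on (closure S) g" "\<And>y. y \<in> S \<Longrightarrow> g y = mi_deriv \<alpha> u y"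
    using \<alpha>(2) C2(3) by metis
  have ext_eq: "mi_deriv_ext S \<alpha> u y = g y" if "y \<in> closure S" for y
    unfolding mi_deriv_ext_def using assms(1) g that by (rule Lim_within_eq_extension)
  have "compact ((\<lambda>y. \<bar>g y\<bar>) ` closure S)"
    using assms(2) g(1) by (intro compact_continuous_image continuous_intros) auto
  then have "bdd_above ((\<lambda>y. \<bar>mi_deriv_ext S \<alpha> u y\<bar>) ` closure S)"
    using ext_eq by (auto dest!: compact_imp_bounded bounded_imp_bdd_above cong: image_cong)
  then have "\<bar>mi_deriv_ext S \<alpha> u x\<bar> \<le> (SUP y\<in>closure S. \<bar>mi_deriv_ext S \<alpha> u y\<bar>)"
    using assms(4) closure_subset by (intro cSUP_upper) auto
  also have "\<dots> \<le> D2_norm S u"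
    unfolding D2_norm_def using \<alpha>(1) finite_mi_order by (intro Max_ge) auto
  also have "mi_deriv_ext S \<alpha> u x = partial_deriv j (partial_deriv i u) x"
    using ext_eq[of x] g(2)[OF assms(4)] \<alpha>(2) assms(4) subsetD[OF closure_subset assms(4)]
      partial_deriv_commute[OF assms(1,4) C2(1,2), of i j] by auto
  finally show ?thesis .
qed

section \<open>Sums over nodes of bounded density\<close>

text \<open>The sum factors into one-dimensional sums, each dominated by two geometric series,
  whence a bound independent of the box size \<open>N\<close>.\<close>

lemma exp_minus_l1_grid_sum_le:
  fixes c :: real and N :: int
  assumes "c > 0"
  shows "(\<Sum>k\<in>(UNIV :: 'n::finite set) \<rightarrow>\<^sub>E {-N..N}. \<Prod>i\<in>UNIV. exp (- c * \<bar>real_of_int (k i)\<bar>))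
           \<le> (2 / (1 - exp (- c))) ^ CARD('n)"
proof -
  define q where "q = exp (- c)"
  have q: "0 < q" "q < 1" using assms by (auto simp: q_def)
  have half: "(\<Sum>k\<in>{0..N}. exp (- c * \<bar>real_of_int k\<bar>)) \<le> 1 / (1 - q)"
  proof -
    have "(\<Sum>k\<in>{0..N}. exp (- c * \<bar>real_of_int k\<bar>)) = (\<Sum>k\<in>nat ` {0..N}. q ^ k)"
      by (subst sum.reindex) (auto simp: inj_on_def q_def simp flip: exp_of_nat_mult intro!: sum.cong)
    also have "\<dots> \<le> (\<Sum>k. q ^ k)"
      using q by (intro sum_le_suminf summable_geometric) auto
    also have "\<dots> = 1 / (1 - q)"
      using q by (intro suminf_geometric) auto
    finally show ?thesis .
  qed
  have "(\<Sum>k\<in>{-N..N}. exp (- c * \<bar>real_of_int k\<bar>)) \<le> 2 / (1 - q)"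
  proof -
    have "(\<Sum>k\<in>{-N..N}. exp (- c * \<bar>real_of_int k\<bar>))
        \<le> (\<Sum>k\<in>{0..N} \<union> uminus ` {0..N}. exp (- c * \<bar>real_of_int k\<bar>))"
    proof (rule sum_mono2)
      show "{-N..N} \<subseteq> {0..N} \<union> uminus ` {0..N}"
      proof
        fix k assume "k \<in> {-N..N}"
        then show "k \<in> {0..N} \<union> uminus ` {0..N}"
          by (cases "0 \<le> k") auto
      qed
    qed auto
    \<comment> \<open>Index 0 lies in both halves; counting it twice only enlarges the
      bound.\<close>
    also have "\<dots> \<le> (\<Sum>k\<in>{0..N}. exp (- c * \<bar>real_of_int k\<bar>)) + (\<Sum>k\<in>uminus ` {0..N}. exp (- c * \<bar>real_of_int k\<bar>))"
      using sum.union_inter[of "{0..N}" "uminus ` {0..N}" "\<lambda>k. exp (- c * \<bar>real_of_int k\<bar>)"]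
        sum_nonneg[of "{0..N} \<inter> uminus ` {0..N}" "\<lambda>k. exp (- c * \<bar>real_of_int k\<bar>)"]
      by simp
    also have "(\<Sum>k\<in>uminus ` {0..N}. exp (- c * \<bar>real_of_int k\<bar>)) = (\<Sum>k\<in>{0..N}. exp (- c * \<bar>real_of_int k\<bar>))"
      by (subst sum.reindex) (auto simp: inj_on_def)
    finally show ?thesis using half by simp
  qed
  then have "(\<Prod>i\<in>(UNIV :: 'n set). \<Sum>k\<in>{-N..N}. exp (- c * \<bar>real_of_int k\<bar>)) \<le> (\<Prod>i\<in>(UNIV :: 'n set). 2 / (1 - q))"
    by (intro prod_mono) (auto intro!: sum_nonneg)
  then show ?thesis
    by (subst (asm) prod_sum_PiE) (simp_all add: q_def)
qed

text \<open>Cells of a cubic grid of mesh \<open>h / d\<close> have diameter at most \<open>h\<close>, so each contains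
  at most \<open>\<tau>\<close> nodes.\<close>

lemma exp_minus_dist_sum_bounded:
  fixes \<tau> :: real
  shows "\<exists>S\<ge>1. \<forall>(I :: nat set) (X :: nat \<Rightarrow> real^'n::finite) h x.
    finite I \<longrightarrow> inj_on X I \<longrightarrow> h > 0 \<longrightarrow> h_density_bounded h \<tau> (X ` I) \<longrightarrow>
    (\<Sum>a\<in>I. exp (- (norm (X a - x) / h))) \<le> S"
proof -
  define d where "d = real CARD('n)"
  have d: "d \<ge> 1" by (simp add: d_def Suc_leI)
  \<comment> \<open>At this rate the bounds \<open>1 + d * norm (X a - x) / h\<close> on the
    \<open>d\<close> cell coordinates, summed and multiplied by \<open>c\<close>, give exactly
    \<open>d * c + norm (X a - x) / h\<close>.\<close>
  define c where "c = 1 / d\<^sup>2"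
  have c: "c > 0" using d by (simp add: c_def)
  \<comment> \<open>No sign of \<open>\<tau>\<close> is assumed here, hence the absolute value. The
    maximum with 1 later makes \<open>ln S0\<close> nonnegative.\<close>
  define S where "S = max 1 (\<bar>\<tau>\<bar> * (exp (d * c) * (2 / (1 - exp (- c))) ^ CARD('n)))"
  have "(\<Sum>a\<in>I. exp (- (norm (X a - x) / h))) \<le> S"
    if I: "finite I" and inj: "inj_on X I" and h: "h > 0" and dens: "h_density_bounded h \<tau> (X ` I)"
    for I :: "nat set" and X :: "nat \<Rightarrow> real^'n" and h x
  proof -
    define k where "k a = (\<lambda>i. \<lfloor>d * ((X a - x) $ i) / h\<rfloor>)" for a
    define E where "E \<kappa> = exp (d * c) * (\<Prod>i\<in>UNIV. exp (- c * \<bar>real_of_int (\<kappa> i)\<bar>))" for \<kappa> :: "'n \<Rightarrow> int"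
    have E0: "0 \<le> E \<kappa>" for \<kappa> by (simp add: E_def prod_nonneg)
    have fiber: "real (card {a\<in>I. k a = \<kappa>}) \<le> \<bar>\<tau>\<bar>" for \<kappa>
    proof -
      \<comment> \<open>The lower corner of the cell \<open>\<kappa>\<close>, which has side
        \<open>h / d\<close>; nodes of the cell are within l1 distance \<open>h\<close> of
        it.\<close>
      define z where "z = x + (h / d) *\<^sub>R (\<chi> i. real_of_int (\<kappa> i))"
      have "norm (X a - z) \<le> h" if "k a = \<kappa>" for a
      proof -
        have "\<bar>(X a - z) $ i\<bar> \<le> h / d" for i
        proof -
          have "\<kappa> i = \<lfloor>d * ((X a - x) $ i) / h\<rfloor>" using that by (auto simp: k_def)
          then have bds: "real_of_int (\<kappa> i) \<le> d * ((X a - x) $ i) / h" "d * ((X a - x) $ i) / h \<le> real_of_int (\<kappa> i) + 1"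
            by linarith+
          have "0 \<le> h / d" using h d by simp
          note mult_left_mono[OF bds(1) this] mult_left_mono[OF bds(2) this]
          moreover have "h / d * (d * ((X a - x) $ i) / h) = (X a - x) $ i"
            using h d by simp
          ultimately have "0 \<le> (X a - x) $ i - h / d * \<kappa> i" "(X a - x) $ i - h / d * \<kappa> i \<le> h / d"
            by (simp_all add: distrib_left)
          then show ?thesis by (simp add: z_def algebra_simps)
        qed
        then have "norm (X a - z) \<le> (\<Sum>i\<in>(UNIV :: 'n set). h / d)"
          by (intro order_trans[OF norm_le_l1_cart] sum_mono) auto
        then show ?thesis using d by (simp add: d_def)
      qed
      then have "X ` {a\<in>I. k a = \<kappa>} \<subseteq> X ` I \<inter> cball z h"
        by (auto simp: dist_norm norm_minus_commute)
      then have "card (X ` {a\<in>I. k a = \<kappa>}) \<le> card (X ` I \<inter> cball z h)"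
        using I by (intro card_mono) auto
      moreover have "card (X ` {a\<in>I. k a = \<kappa>}) = card {a\<in>I. k a = \<kappa>}"
        using inj by (intro card_image) (auto intro: inj_on_subset)
      moreover have "real (card (X ` I \<inter> cball z h)) \<le> \<tau>"
        using dens by (auto simp: h_density_bounded_def)
      ultimately show ?thesis by linarith
    qed
    have pointwise: "exp (- (norm (X a - x) / h)) \<le> E (k a)" for a
    proof -
      have "\<bar>real_of_int (k a i)\<bar> \<le> 1 + d * norm (X a - x) / h" for i
      proof -
        have "\<bar>(X a - x) $ i\<bar> \<le> norm (X a - x)" by (rule component_le_norm_cart)
        then have "\<bar>d * ((X a - x) $ i) / h\<bar> \<le> d * norm (X a - x) / h"
          using h d by (simp add: abs_mult divide_right_mono del: vector_minus_component)
        moreover have "\<bar>real_of_int \<lfloor>t\<rfloor>\<bar> \<le> 1 + \<bar>t\<bar>" for t :: real by linarith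
        ultimately show ?thesis unfolding k_def by (meson add_left_mono order_trans)
      qed
      then have "(\<Sum>i\<in>(UNIV :: 'n set). \<bar>real_of_int (k a i)\<bar>) \<le> (\<Sum>i\<in>(UNIV :: 'n set). 1 + d * norm (X a - x) / h)"
        by (intro sum_mono)
      also have "\<dots> = d * (1 + d * norm (X a - x) / h)"
        by (simp add: d_def)
      finally have "c * (\<Sum>i\<in>UNIV. \<bar>real_of_int (k a i)\<bar>) \<le> c * (d * (1 + d * norm (X a - x) / h))"
        using c by (intro mult_left_mono) auto
      also have "\<dots> = d * c + norm (X a - x) / h"
        using d by (simp add: c_def power2_eq_square field_simps)
      finally show ?thesis
        by (simp add: E_def sum_distrib_left sum_negf flip: exp_sum exp_add)
    qed
    \<comment> \<open>The box must contain all occupied cells; 0 is inserted for the case of no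
      nodes.\<close>
    define N where "N = Max (insert 0 ((\<lambda>(a, i). \<bar>k a i\<bar>) ` (I \<times> UNIV)))"
    have "\<bar>k a i\<bar> \<le> N" if "a \<in> I" for a i
      unfolding N_def using I that by (intro Max_ge) auto
    then have sub: "k ` I \<subseteq> UNIV \<rightarrow>\<^sub>E {-N..N}"
      by (auto simp: abs_le_iff) (metis minus_le_iff)
    have "(\<Sum>a\<in>I. exp (- (norm (X a - x) / h))) \<le> (\<Sum>a\<in>I. E (k a))"
      by (intro sum_mono pointwise)
    also have "\<dots> = (\<Sum>\<kappa>\<in>k ` I. \<Sum>a\<in>{a\<in>I. k a = \<kappa>}. E (k a))"
      using I by (rule sum.image_gen)
    also have "\<dots> = (\<Sum>\<kappa>\<in>k ` I. real (card {a\<in>I. k a = \<kappa>}) * E \<kappa>)"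
      by (intro sum.cong) auto
    also have "\<dots> \<le> (\<Sum>\<kappa>\<in>k ` I. \<bar>\<tau>\<bar> * E \<kappa>)"
      by (intro sum_mono mult_right_mono fiber E0)
    also have "\<dots> \<le> (\<Sum>\<kappa>\<in>UNIV \<rightarrow>\<^sub>E {-N..N}. \<bar>\<tau>\<bar> * E \<kappa>)"
      using sub E0 by (intro sum_mono2 finite_PiE) auto
    also have "\<dots> = \<bar>\<tau>\<bar> * (exp (d * c) * (\<Sum>\<kappa>\<in>(UNIV :: 'n set) \<rightarrow>\<^sub>E {-N..N}. \<Prod>i\<in>UNIV. exp (- c * \<bar>real_of_int (\<kappa> i)\<bar>)))"
      by (simp add: E_def sum_distrib_left)
    also have "\<dots> \<le> \<bar>\<tau>\<bar> * (exp (d * c) * (2 / (1 - exp (- c))) ^ CARD('n))"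
      by (intro mult_left_mono exp_minus_l1_grid_sum_le c) auto
    also have "\<dots> \<le> S" by (simp add: S_def)
    finally show ?thesis .
  qed
  moreover have "S \<ge> 1" by (simp add: S_def)
  ultimately show ?thesis by blast
qed

section \<open>Gibbs form of the weights\<close>

text \<open>Otherwise an open half-space missing \<open>z\<close> would contain \<open>V\<close> and
  hence its hull.\<close>

lemma convex_hull_support_point:
  fixes v :: "'a::euclidean_space"
  assumes "z \<in> convex hull V"
  obtains y where "y \<in> V" "v \<bullet> z \<le> v \<bullet> y"
proof (rule ccontr)
  assume "\<not> thesis"
  then have "V \<subseteq> {y. v \<bullet> y < v \<bullet> z}"
    using that by force
  then have "convex hull V \<subseteq> {y. v \<bullet> y < v \<bullet> z}"
    by (intro hull_minimal convex_halfspace_lt)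
  then show False using assms by auto
qed

lemma closed_conv_finite: "finite P \<Longrightarrow> closed_conv P = convex hull P"
  by (simp add: closed_conv_def finite_imp_compact_convex_hull compact_imp_closed)

section \<open>Exponential families on finitely many nodes: the mean map and its inverse\<close>

locale exponential_family =
  fixes I :: "'i set" and b :: "'i \<Rightarrow> real" and X :: "'i \<Rightarrow> 'a::euclidean_space"
  assumes finite: "finite I" and nonempty: "I \<noteq> {}" and b_pos: "a \<in> I \<Longrightarrow> 0 < b a"
begin

definition Z :: "'a \<Rightarrow> real" where
  "Z \<mu> = (\<Sum>a\<in>I. b a * exp (\<mu> \<bullet> X a))"

definition p :: "'a \<Rightarrow> 'i \<Rightarrow> real" where
  "p \<mu> a = b a * exp (\<mu> \<bullet> X a) / Z \<mu>"

definition mean :: "'a \<Rightarrow> 'a" where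
  "mean \<mu> = (\<Sum>a\<in>I. p \<mu> a *\<^sub>R X a)"

text \<open>The Hessian of \<open>ln (Z \<mu>)\<close> applied to \<open>v\<close>; the gradient is
  \<open>mean \<mu>\<close>.\<close>

definition cov :: "'a \<Rightarrow> 'a \<Rightarrow> 'a" where
  "cov \<mu> v = (\<Sum>a\<in>I. (p \<mu> a * (v \<bullet> (X a - mean \<mu>))) *\<^sub>R (X a - mean \<mu>))"

lemma Z_pos: "0 < Z \<mu>"
  unfolding Z_def using finite nonempty b_pos by (intro sum_pos) auto

lemma p_pos: "a \<in> I \<Longrightarrow> 0 < p \<mu> a"
  using Z_pos b_pos by (simp add: p_def)

lemma sum_p: "(\<Sum>a\<in>I. p \<mu> a) = 1"
  using Z_pos[of \<mu>] by (simp add: p_def Z_def flip: sum_divide_distrib)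

lemma sum_p_centered: "(\<Sum>a\<in>I. p \<mu> a *\<^sub>R (X a - mean \<mu>)) = 0"
  by (simp add: scaleR_diff_right sum_subtractf sum_p flip: scaleR_left.sum) (simp add: mean_def)

lemma p_has_derivative:
  "((\<lambda>\<mu>. p \<mu> a) has_derivative (\<lambda>v. p \<mu> a * (v \<bullet> (X a - mean \<mu>)))) (at \<mu>)"
proof -
  have Z: "(Z has_derivative (\<lambda>v. Z \<mu> * (v \<bullet> mean \<mu>))) (at \<mu>)"
  proof -
    have "(Z has_derivative (\<lambda>v. \<Sum>c\<in>I. b c * (exp (\<mu> \<bullet> X c) * (v \<bullet> X c)))) (at \<mu>)"
      unfolding Z_def[abs_def] by (auto intro!: derivative_eq_intros simp: mult_ac)
    moreover have "(\<Sum>c\<in>I. b c * (exp (\<mu> \<bullet> X c) * (v \<bullet> X c))) = Z \<mu> * (v \<bullet> mean \<mu>)" for v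
      using Z_pos[of \<mu>]
      by (simp add: mean_def p_def inner_sum_right sum_distrib_left mult.assoc)
    ultimately show ?thesis by simp
  qed
  have N: "((\<lambda>\<mu>. b a * exp (\<mu> \<bullet> X a)) has_derivative (\<lambda>v. b a * exp (\<mu> \<bullet> X a) * (v \<bullet> X a))) (at \<mu>)"
    by (auto intro!: derivative_eq_intros simp: mult_ac)
  show ?thesis
    unfolding p_def using has_derivative_divide'[OF N Z] Z_pos[of \<mu>]
    by (auto simp: field_simps inner_diff_right elim!: has_derivative_eq_rhs)
qed

lemma mean_has_derivative: "(mean has_derivative cov \<mu>) (at \<mu>)"
proof -
  have "(mean has_derivative (\<lambda>v. \<Sum>a\<in>I. (p \<mu> a * (v \<bullet> (X a - mean \<mu>))) *\<^sub>R X a)) (at \<mu>)"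
    unfolding mean_def[abs_def]
    by (rule has_derivative_sum, rule has_derivative_scaleR_left)
      (use p_has_derivative in \<open>simp add: mean_def\<close>)
  moreover have "(\<Sum>a\<in>I. (p \<mu> a * (v \<bullet> (X a - mean \<mu>))) *\<^sub>R X a) = cov \<mu> v" for v
  proof -
    \<comment> \<open>These coefficients sum to zero, so \<open>X a\<close> may be replaced by
      \<open>X a - mean \<mu>\<close>.\<close>
    have "(\<Sum>a\<in>I. p \<mu> a * (v \<bullet> (X a - mean \<mu>))) = v \<bullet> (\<Sum>a\<in>I. p \<mu> a *\<^sub>R (X a - mean \<mu>))"
      by (simp add: inner_sum_right)
    then have "(\<Sum>a\<in>I. p \<mu> a * (v \<bullet> (X a - mean \<mu>))) = 0"
      by (simp add: sum_p_centered)
    then show ?thesis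
      by (simp add: cov_def scaleR_diff_right sum_subtractf flip: scaleR_left.sum)
  qed
  ultimately show ?thesis by simp
qed

lemma inner_cov: "v \<bullet> cov \<mu> v = (\<Sum>a\<in>I. p \<mu> a * (v \<bullet> (X a - mean \<mu>))\<^sup>2)"
  by (simp add: cov_def inner_sum_right power2_eq_square mult.assoc)

text \<open>If the quadratic form vanished, all nodes would lie in one hyperplane and their hull
  would have empty interior.\<close>

lemma inner_cov_pos:
  assumes "interior (convex hull (X ` I)) \<noteq> {}" "v \<noteq> 0"
  shows "0 < v \<bullet> cov \<mu> v"
proof -
  have "\<exists>a\<in>I. v \<bullet> (X a - mean \<mu>) \<noteq> 0"
  proof (rule ccontr)
    assume "\<not> ?thesis"
    then have "X ` I \<subseteq> {z. v \<bullet> z = v \<bullet> mean \<mu>}"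
      by (auto simp: inner_diff_right)
    then have "convex hull (X ` I) \<subseteq> {z. v \<bullet> z = v \<bullet> mean \<mu>}"
      by (intro hull_minimal convex_hyperplane)
    from interior_mono[OF this] show False
      using assms by auto
  qed
  then obtain a where a: "a \<in> I" "v \<bullet> (X a - mean \<mu>) \<noteq> 0" by blast
  have nonneg: "0 \<le> p \<mu> c * (v \<bullet> (X c - mean \<mu>))\<^sup>2" if "c \<in> I" for c
    using p_pos[OF that, of \<mu>] by simp
  have "0 < p \<mu> a * (v \<bullet> (X a - mean \<mu>))\<^sup>2"
    using a p_pos[of a \<mu>] by simp
  also have "\<dots> \<le> v \<bullet> cov \<mu> v"
    unfolding inner_cov by (rule member_le_sum) (use a nonneg finite in auto)
  finally show ?thesis .
qed

text \<open>On the line through \<open>\<mu>\<close> and \<open>\<nu>\<close>, the component of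
  \<open>mean\<close> along \<open>\<nu> - \<mu>\<close> has the quadratic form of
  \<open>cov\<close> as derivative, so it is strictly increasing.\<close>

lemma mean_inj:
  assumes "interior (convex hull (X ` I)) \<noteq> {}"
  shows "inj mean"
proof (rule injI, rule ccontr)
  fix \<mu> \<nu> assume eq: "mean \<mu> = mean \<nu>" and "\<mu> \<noteq> \<nu>"
  define v where "v = \<nu> - \<mu>"
  have "v \<noteq> 0" using \<open>\<mu> \<noteq> \<nu>\<close> by (simp add: v_def)
  have D: "((\<lambda>t. v \<bullet> mean (\<mu> + t *\<^sub>R v)) has_real_derivative v \<bullet> cov (\<mu> + t *\<^sub>R v) v) (at t)" for t
  proof -
    have l: "((\<lambda>t. \<mu> + t *\<^sub>R v) has_derivative (\<lambda>t. t *\<^sub>R v)) (at t)"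
      by (auto intro!: derivative_eq_intros)
    have "((\<lambda>t. mean (\<mu> + t *\<^sub>R v)) has_derivative (\<lambda>r. cov (\<mu> + t *\<^sub>R v) (r *\<^sub>R v))) (at t)"
      by (rule has_derivative_compose[OF l mean_has_derivative])
    from has_derivative_inner_right[OF this, of v] show ?thesis
      by (auto simp: has_field_derivative_def cov_def scaleR_sum_right mult_ac
          inner_sum_right sum_distrib_left elim!: has_derivative_eq_rhs)
  qed
  have "v \<bullet> mean (\<mu> + 0 *\<^sub>R v) < v \<bullet> mean (\<mu> + 1 *\<^sub>R v)"
  proof (rule DERIV_pos_imp_increasing[where f = "\<lambda>t. v \<bullet> mean (\<mu> + t *\<^sub>R v)"])
    show "\<exists>d. ((\<lambda>t. v \<bullet> mean (\<mu> + t *\<^sub>R v)) has_real_derivative d) (at t) \<and> 0 < d" for t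
      using D inner_cov_pos[OF assms \<open>v \<noteq> 0\<close>] by blast
  qed simp
  then show False using eq by (simp add: v_def)
qed

text \<open>The function \<open>F\<close> of the proof is
  \<open>Z \<mu> * exp (- (\<mu> \<bullet> y))\<close>, whose critical points solve
  \<open>mean \<mu> = y\<close>. A ball around \<open>y\<close> inside the hull provides for each
  \<open>\<mu>\<close> a node with \<open>\<mu> \<bullet> (X a - y)\<close> at least
  \<open>r * norm \<mu>\<close>; so \<open>F\<close> is coercive and has a minimum.\<close>

lemma mean_surj_interior:
  assumes y: "y \<in> interior (convex hull (X ` I))"
  obtains \<mu> where "mean \<mu> = y"
proof -
  obtain r where r: "0 < r" "cball y r \<subseteq> convex hull (X ` I)"
    using y mem_interior_cball by blast
  define F where "F \<mu> = (\<Sum>a\<in>I. b a * exp (\<mu> \<bullet> (X a - y)))" for \<mu>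
  have F': "(F has_derivative (\<lambda>v. \<Sum>a\<in>I. b a * (exp (\<mu> \<bullet> (X a - y)) * (v \<bullet> (X a - y))))) (at \<mu>)" for \<mu>
    unfolding F_def[abs_def] by (auto intro!: derivative_eq_intros simp: mult_ac)
  define m where "m = Min (b ` I)"
  have m: "0 < m" "\<And>a. a \<in> I \<Longrightarrow> m \<le> b a"
    using finite nonempty b_pos by (auto simp: m_def)
  have coercive: "m * (r * norm \<mu>) \<le> F \<mu>" if "\<mu> \<noteq> 0" for \<mu>
  proof -
    have "y + (r / norm \<mu>) *\<^sub>R \<mu> \<in> convex hull (X ` I)"
      using r that by (intro subsetD[OF r(2)]) (simp add: dist_norm)
    then obtain a where a: "a \<in> I" "\<mu> \<bullet> (y + (r / norm \<mu>) *\<^sub>R \<mu>) \<le> \<mu> \<bullet> X a"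
      using convex_hull_support_point[of _ "X ` I" \<mu>] by blast
    then have "r * norm \<mu> \<le> \<mu> \<bullet> (X a - y)"
      using that by (simp add: inner_add_right inner_diff_right dot_square_norm power2_eq_square)
    then have "r * norm \<mu> \<le> exp (\<mu> \<bullet> (X a - y))"
      using exp_ge_add_one_self[of "\<mu> \<bullet> (X a - y)"] by linarith
    then have "m * (r * norm \<mu>) \<le> b a * exp (\<mu> \<bullet> (X a - y))"
      using m a r less_imp_le[OF b_pos] by (intro mult_mono) auto
    also have "\<dots> \<le> F \<mu>"
      unfolding F_def by (rule member_le_sum) (use a finite b_pos in \<open>auto intro!: mult_nonneg_nonneg less_imp_le\<close>)
    finally show ?thesis .
  qed
  \<comment> \<open>Beyond this radius the coercive lower bound exceeds \<open>F 0\<close>, so a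
    minimum over the ball is global.\<close>
  define R where "R = F 0 / (m * r)"
  have F0: "0 \<le> F 0"
    unfolding F_def by (intro sum_nonneg mult_nonneg_nonneg) (auto intro: less_imp_le b_pos)
  then have R: "0 \<le> R" using m r by (simp add: R_def)
  have "continuous_on (cball 0 R) F"
    by (intro continuous_at_imp_continuous_on ballI has_derivative_continuous[OF F'])
  then obtain \<mu> where \<mu>: "\<mu> \<in> cball 0 R" "\<And>\<nu>. \<nu> \<in> cball 0 R \<Longrightarrow> F \<mu> \<le> F \<nu>"
    using continuous_attains_inf[of "cball 0 R" F] R by auto
  have "F \<mu> \<le> F \<nu>" for \<nu>
  proof (cases "\<nu> \<in> cball 0 R")
    case False
    then have "R < norm \<nu>" "\<nu> \<noteq> 0" using R by auto
    then have "F 0 \<le> m * r * norm \<nu>"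
      using m r by (simp add: R_def pos_divide_less_eq mult.commute)
    also have "\<dots> \<le> F \<nu>" using coercive[OF \<open>\<nu> \<noteq> 0\<close>] by (simp add: mult.assoc)
    finally show ?thesis using \<mu>(2)[of 0] R by simp
  qed (use \<mu> in blast)
  then have "(\<lambda>v. \<Sum>a\<in>I. b a * (exp (\<mu> \<bullet> (X a - y)) * (v \<bullet> (X a - y)))) = (\<lambda>v. 0)"
    by (intro differential_zero_maxmin[OF _ _ F', of _ UNIV]) auto
  then have zero: "(\<Sum>a\<in>I. b a * (exp (\<mu> \<bullet> (X a - y)) * (v \<bullet> (X a - y)))) = 0" for v
    by meson
  have "v \<bullet> (mean \<mu> - y) = 0" for v
  proof -
    have eq: "b a * (exp (\<mu> \<bullet> (X a - y)) * (v \<bullet> (X a - y))) = Z \<mu> * exp (- (\<mu> \<bullet> y)) * (p \<mu> a * (v \<bullet> (X a - y)))" for a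
      using Z_pos[of \<mu>] by (simp add: p_def inner_diff_right exp_diff exp_minus field_simps)
    have "Z \<mu> * exp (- (\<mu> \<bullet> y)) * (\<Sum>a\<in>I. p \<mu> a * (v \<bullet> (X a - y))) = 0"
      using zero[of v] unfolding eq sum_distrib_left .
    then have "(\<Sum>a\<in>I. p \<mu> a * (v \<bullet> (X a - y))) = 0"
      using Z_pos[of \<mu>] by simp
    moreover have "(\<Sum>a\<in>I. p \<mu> a * (v \<bullet> (X a - y))) = v \<bullet> mean \<mu> - v \<bullet> y"
      by (simp add: mean_def inner_diff_right inner_sum_right right_diff_distrib sum_subtractf sum_p
          flip: sum_distrib_right)
    ultimately show ?thesis by (simp add: inner_diff_right)
  qed
  from this[of "mean \<mu> - y"] have "mean \<mu> = y" by simp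
  then show ?thesis using that by blast
qed

text \<open>Positive definiteness makes \<open>cov \<mu>\<close> invertible and injectivity makes
  \<open>inv mean\<close> a left inverse, so the inverse function theorem applies; the weights
  follow by the chain rule.\<close>

lemma mean_inverse_derivative:
  assumes y: "mean \<mu> = y" "y \<in> interior (convex hull (X ` I))"
  shows "cov \<mu> (inv (cov \<mu>) v) = v"
    and "((\<lambda>z. p (inv mean z) a) has_derivative (\<lambda>v. p \<mu> a * (inv (cov \<mu>) v \<bullet> (X a - y)))) (at y)"
proof -
  have ne: "interior (convex hull (X ` I)) \<noteq> {}" using y by blast
  have lin: "linear (cov \<mu>)"
    by (rule has_derivative_linear[OF mean_has_derivative])
  have "inj (cov \<mu>)"
  proof (rule linear_injective_0[OF lin, THEN iffD2], intro allI impI)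
    fix v assume "cov \<mu> v = 0"
    then show "v = 0"
      using inner_cov_pos[OF ne, of v \<mu>] by force
  qed
  then have "surj (cov \<mu>)"
    using linear_inj_imp_surj[OF lin] by blast
  then have id: "cov \<mu> \<circ> inv (cov \<mu>) = id"
    by (simp add: surj_iff)
  have \<mu>: "inv mean y = \<mu>"
    using y(1) mean_inj[OF ne] by auto
  have D: "(inv mean has_derivative inv (cov \<mu>)) (at y)"
    unfolding y(1)[symmetric]
  proof (rule has_derivative_inverse_strong[where S = UNIV and f = mean])
    show "continuous_on UNIV mean"
      by (intro continuous_at_imp_continuous_on ballI has_derivative_continuous[OF mean_has_derivative])
    show "inv mean (mean \<nu>) = \<nu>" for \<nu>
      using mean_inj[OF ne] by simp
  qed (use mean_has_derivative id in auto)
  have "((\<lambda>\<mu>. p \<mu> a) has_derivative (\<lambda>v. p \<mu> a * (v \<bullet> (X a - y)))) (at (inv mean y))"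
    using p_has_derivative[of a \<mu>] unfolding \<mu> y(1) .
  from has_derivative_compose[OF D this]
  show "((\<lambda>z. p (inv mean z) a) has_derivative (\<lambda>v. p \<mu> a * (inv (cov \<mu>) v \<bullet> (X a - y)))) (at y)" .
  show "cov \<mu> (inv (cov \<mu>) v) = v"
    using fun_cong[OF id, of v] by simp
qed

end

section \<open>Entropy minimization: the weights as members of an exponential family\<close>

lemma gibbs_inequality:
  fixes v q :: real
  assumes "0 \<le> v" "0 < q"
  shows "v - q \<le> v * (ln v - ln q)" "v * (ln v - ln q) = v - q \<Longrightarrow> v = q"
proof -
  have *: "v - q \<le> v * (ln v - ln q) \<and> (v * (ln v - ln q) = v - q \<longrightarrow> v = q)"
  proof (cases "v = 0")
    case False
    then have v: "0 < v" using assms by simp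
    have ln: "ln (q / v) = - (ln v - ln q)"
      using v assms by (simp add: ln_div)
    \<comment> \<open>Both claims come from the bound \<open>ln s \<le> s - 1\<close> at
      \<open>s = q / v\<close>, an equality only for \<open>s = 1\<close>.\<close>
    have "ln (q / v) \<le> q / v - 1"
      using v assms by (intro ln_le_minus_one) auto
    then have "v * ln (q / v) \<le> v * (q / v - 1)"
      using v by (intro mult_left_mono) auto
    moreover have mq: "v * (q / v - 1) = q - v"
      using v by (simp add: right_diff_distrib)
    moreover have lnv: "v * ln (q / v) = - (v * (ln v - ln q))"
      unfolding ln by (simp only: mult_minus_right)
    ultimately have "v - q \<le> v * (ln v - ln q)" by linarith
    moreover have "v = q" if "v * (ln v - ln q) = v - q"
    proof -
      have "v * ln (q / v) = v * (q / v - 1)"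
        unfolding lnv mq that by simp
      then have "ln (q / v) = q / v - 1"
        using v by simp
      then have "q / v = 1"
        using v assms by (intro ln_eq_minus_one) auto
      then show ?thesis using v by simp
    qed
    ultimately show ?thesis by blast
  qed (use assms in auto)
  then show "v - q \<le> v * (ln v - ln q)" "v * (ln v - ln q) = v - q \<Longrightarrow> v = q" by blast+
qed

locale gaussian_family =
  fixes I :: "'i set" and \<beta> :: real and X :: "'i \<Rightarrow> 'a::euclidean_space"
  assumes finite_I: "finite I" and I_nonempty: "I \<noteq> {}" and \<beta>_pos: "0 < \<beta>"

text \<open>The base weights contain \<open>X a\<close> but not \<open>x\<close>, so one family
  serves all \<open>x\<close>: the rest of the squared distance is affine in \<open>X a\<close> and
  goes into the parameter and the normalization.\<close>

sublocale gaussian_family \<subseteq> exponential_family I "\<lambda>a. exp (- (\<beta> * (norm (X a))\<^sup>2))" X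
  using finite_I I_nonempty by unfold_locales auto

context gaussian_family
begin

text \<open>The constraints turn all terms affine in \<open>X a\<close> into constants. What still
  depends on \<open>v\<close> is its entropy relative to \<open>p \<mu>\<close>, for any choice of
  \<open>\<mu>\<close>.\<close>

lemma lme_objective_eq:
  assumes "lme_feasible I X x v"
  shows "lme_objective I X \<beta> x v =
    (\<mu> \<bullet> x - ln (Z \<mu>)) / \<beta> - (norm x)\<^sup>2 + (\<Sum>a\<in>I. v a * (ln (v a) - ln (p \<mu> a))) / \<beta>"
proof -
  have v: "(\<Sum>a\<in>I. v a) = 1" "(\<Sum>a\<in>I. v a *\<^sub>R X a) = x"
    using assms by (auto simp: lme_feasible_def)
  have inner: "(\<Sum>a\<in>I. v a * (c \<bullet> X a)) = c \<bullet> x" for c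
    by (simp add: v(2)[symmetric] inner_sum_right)
  have lnp: "ln (p \<mu> a) = - \<beta> * (norm (X a))\<^sup>2 + \<mu> \<bullet> X a - ln (Z \<mu>)" for a
    using Z_pos[of \<mu>] by (simp add: p_def ln_div ln_mult)
  have summand: "\<beta> * (v a * (norm (x - X a))\<^sup>2) + v a * ln (v a) =
      v a * (\<beta> * (norm x)\<^sup>2 - ln (Z \<mu>)) - 2 * \<beta> * (v a * (x \<bullet> X a)) + v a * (\<mu> \<bullet> X a)
        + v a * (ln (v a) - ln (p \<mu> a))" for a
    unfolding lnp by (simp add: power2_norm_eq_inner inner_diff_left inner_diff_right inner_commute algebra_simps)
  have "\<beta> * lme_objective I X \<beta> x v = (\<Sum>a\<in>I. \<beta> * (v a * (norm (x - X a))\<^sup>2) + v a * ln (v a))"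
    using \<beta>_pos by (simp add: lme_objective_def distrib_left sum.distrib sum_distrib_left)
  also have "\<dots> = \<beta> * (norm x)\<^sup>2 - ln (Z \<mu>) - 2 * \<beta> * (x \<bullet> x) + \<mu> \<bullet> x
      + (\<Sum>a\<in>I. v a * (ln (v a) - ln (p \<mu> a)))"
    unfolding summand by (simp add: sum.distrib sum_subtractf inner v(1) flip: sum_distrib_left sum_distrib_right)
  finally have "\<beta> * lme_objective I X \<beta> x v = \<mu> \<bullet> x - ln (Z \<mu>) - \<beta> * (norm x)\<^sup>2
      + (\<Sum>a\<in>I. v a * (ln (v a) - ln (p \<mu> a)))"
    by (simp add: power2_norm_eq_inner)
  moreover have "lme_objective I X \<beta> x v = \<beta> * lme_objective I X \<beta> x v / \<beta>"
    using \<beta>_pos by simp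
  ultimately show ?thesis
    using \<beta>_pos by (simp only: add_divide_distrib diff_divide_distrib) simp
qed

text \<open>\<open>p \<mu>\<close> is feasible and has relative entropy zero, so that of the
  minimizer is at most zero; Gibbs' inequality then forces equality at each node.\<close>

lemma lme_minimizer_eq_gibbs:
  assumes min: "is_arg_min (lme_objective I X \<beta> x) (lme_feasible I X x) v"
    and mean: "mean \<mu> = x" and "a \<in> I"
  shows "v a = p \<mu> a"
proof -
  have v: "lme_feasible I X x v" using min by (simp add: is_arg_min_def)
  have p: "lme_feasible I X x (p \<mu>)"
    using mean by (auto simp: lme_feasible_def sum_p mean_def intro: less_imp_le p_pos)
  have "lme_objective I X \<beta> x v \<le> lme_objective I X \<beta> x (p \<mu>)"
    using min p by (auto simp: is_arg_min_def not_less)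
  then have "(\<Sum>a\<in>I. v a * (ln (v a) - ln (p \<mu> a))) \<le> 0"
    unfolding lme_objective_eq[OF v, of \<mu>] lme_objective_eq[OF p, of \<mu>]
    using \<beta>_pos by (simp add: divide_le_0_iff)
  \<comment> \<open>Subtracting these differences leaves the sum unchanged but makes every summand
    nonnegative.\<close>
  moreover have "(\<Sum>a\<in>I. v a - p \<mu> a) = 0"
    using v by (simp add: sum_subtractf sum_p lme_feasible_def)
  ultimately have "(\<Sum>a\<in>I. v a * (ln (v a) - ln (p \<mu> a)) - (v a - p \<mu> a)) \<le> 0"
    by (simp only: sum_subtractf)
  moreover have nonneg: "0 \<le> v a * (ln (v a) - ln (p \<mu> a)) - (v a - p \<mu> a)" if "a \<in> I" for a
    using gibbs_inequality(1)[of "v a" "p \<mu> a"] v p_pos[OF that] that by (auto simp: lme_feasible_def)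
  ultimately have "v a * (ln (v a) - ln (p \<mu> a)) - (v a - p \<mu> a) = 0"
    using sum_nonneg_0[OF finite_I, of "\<lambda>a. v a * (ln (v a) - ln (p \<mu> a)) - (v a - p \<mu> a)"]
      sum_nonneg[of I "\<lambda>a. v a * (ln (v a) - ln (p \<mu> a)) - (v a - p \<mu> a)"] nonneg \<open>a \<in> I\<close> antisym by blast
  then show ?thesis
    using gibbs_inequality(2)[of "v a" "p \<mu> a"] v p_pos \<open>a \<in> I\<close> by (auto simp: lme_feasible_def)
qed

text \<open>Recentring at \<open>x\<close> exhibits the multiplier
  \<open>\<mu> - (2 * \<beta>) *\<^sub>R x\<close>; the remaining factor is common to all nodes and
  cancels.\<close>

lemma p_recentred:
  "p \<mu> a = exp (- \<beta> * (norm (X a - x))\<^sup>2 + (\<mu> - (2 * \<beta>) *\<^sub>R x) \<bullet> (X a - x)) /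
    (\<Sum>c\<in>I. exp (- \<beta> * (norm (X c - x))\<^sup>2 + (\<mu> - (2 * \<beta>) *\<^sub>R x) \<bullet> (X c - x)))"
proof -
  define K where "K = \<mu> \<bullet> x - \<beta> * (x \<bullet> x)"
  have "- \<beta> * (norm (X c))\<^sup>2 + \<mu> \<bullet> X c
      = K + (- \<beta> * (norm (X c - x))\<^sup>2 + (\<mu> - (2 * \<beta>) *\<^sub>R x) \<bullet> (X c - x))" for c
    by (simp add: K_def power2_norm_eq_inner inner_diff_left inner_diff_right inner_commute algebra_simps)
  then have eq: "exp (- (\<beta> * (norm (X c))\<^sup>2)) * exp (\<mu> \<bullet> X c)
      = exp K * exp (- \<beta> * (norm (X c - x))\<^sup>2 + (\<mu> - (2 * \<beta>) *\<^sub>R x) \<bullet> (X c - x))" for c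
    by (simp only: mult_minus_left flip: exp_add)
  show ?thesis
    unfolding p_def Z_def eq sum_distrib_left[symmetric] by simp
qed

end

text \<open>The multiplier \<open>\<theta>\<close> is the paper's \<open>- \<lambda>\<^sup>*(x)\<close>, and \<open>G\<close> is the inverse of
  \<open>J = (\<Sum>a\<in>I. w a x *\<^sub>R (X a - x) (X a - x)\<^sup>T)\<close>.\<close>

lemma lme_scheme_gibbs_form:
  fixes X :: "'i \<Rightarrow> 'a::euclidean_space"
  assumes "finite I" "0 < \<beta>" "lme_scheme I X \<beta> w" "x \<in> open_conv (X ` I)"
  shows "\<exists>\<theta> G.
    (\<forall>a\<in>I. w a x = exp (- \<beta> * (norm (X a - x))\<^sup>2 + \<theta> \<bullet> (X a - x)) /
        (\<Sum>b\<in>I. exp (- \<beta> * (norm (X b - x))\<^sup>2 + \<theta> \<bullet> (X b - x)))) \<and>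
    (\<forall>v. (\<Sum>a\<in>I. (w a x * (G v \<bullet> (X a - x))) *\<^sub>R (X a - x)) = v) \<and>
    (\<forall>a\<in>I. (w a has_derivative (\<lambda>v. w a x * (G v \<bullet> (X a - x)))) (at x))"
proof -
  have conv: "closed_conv (X ` I) = convex hull (X ` I)"
    using assms by (simp add: closed_conv_finite)
  have int: "open_conv (X ` I) = interior (convex hull (X ` I))"
    by (simp add: open_conv_def conv)
  have "I \<noteq> {}" using assms int by auto
  interpret gaussian_family I \<beta> X
    using assms \<open>I \<noteq> {}\<close> by unfold_locales
  have x: "x \<in> interior (convex hull (X ` I))" using assms int by simp
  have inv: "mean (inv mean y) = y" if "y \<in> interior (convex hull (X ` I))" for y
    using mean_surj_interior[OF that] by (metis f_inv_into_f rangeI)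
  have w: "w a y = p (inv mean y) a" if "y \<in> interior (convex hull (X ` I))" "a \<in> I" for y a
  proof (rule lme_minimizer_eq_gibbs)
    show "is_arg_min (lme_objective I X \<beta> y) (lme_feasible I X y) (\<lambda>a. w a y)"
      using assms(3) that interior_subset conv by (auto simp: lme_scheme_def)
  qed (use inv that in auto)
  define \<mu> where "\<mu> = inv mean x"
  define G where "G = inv (cov \<mu>)"
  note G = mean_inverse_derivative[OF inv[OF x, folded \<mu>_def] x, folded G_def]
  show ?thesis
  proof (intro exI[of _ "\<mu> - (2 * \<beta>) *\<^sub>R x"] exI[of _ G] conjI allI ballI)
    show "w a x = exp (- \<beta> * (norm (X a - x))\<^sup>2 + (\<mu> - (2 * \<beta>) *\<^sub>R x) \<bullet> (X a - x)) /
        (\<Sum>c\<in>I. exp (- \<beta> * (norm (X c - x))\<^sup>2 + (\<mu> - (2 * \<beta>) *\<^sub>R x) \<bullet> (X c - x)))" if "a \<in> I" for a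
      unfolding w[OF x that] \<mu>_def by (rule p_recentred)
    show "(\<Sum>a\<in>I. (w a x * (G v \<bullet> (X a - x))) *\<^sub>R (X a - x)) = v" for v
      using G(1)[of v] w[OF x] inv[OF x] by (simp add: cov_def \<mu>_def)
    \<comment> \<open>The formula for \<open>w a\<close> holds on the whole interior, an open set,
      so the derivative carries over.\<close>
    show "(w a has_derivative (\<lambda>v. w a x * (G v \<bullet> (X a - x)))) (at x)" if "a \<in> I" for a
    proof (rule has_derivative_transform_within_open[OF _ open_interior x])
      show "((\<lambda>z. p (inv mean z) a) has_derivative (\<lambda>v. w a x * (G v \<bullet> (X a - x)))) (at x)"
        using G(2) w[OF x that] by (simp add: \<mu>_def)
    qed (use w that in auto)
  qed
qed

section \<open>Moment bounds\<close>

text \<open>The node is a vertex of a covering simplex that contains \<open>z\<close>; both lie in a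
  ball of diameter at most \<open>h\<close>.\<close>

lemma h_covering_node:
  fixes v :: "'a::euclidean_space"
  assumes "h_covering h P A" "z \<in> A"
  obtains y where "y \<in> P" "norm (y - z) \<le> h" "v \<bullet> z \<le> v \<bullet> y"
proof -
  obtain V where V: "V \<subseteq> P" "card V = DIM('a) + 1" "ball_size (convex hull V) < h" "z \<in> convex hull V"
    using assms unfolding h_covering_def by blast
  let ?R = "{r. 0 \<le> r \<and> (\<exists>c. convex hull V \<subseteq> cball c r)}"
  have "finite V" using V(2) by (metis Suc_eq_plus1 card.infinite nat.distinct(1))
  then have "bounded (convex hull V)"
    by (simp add: bounded_convex_hull finite_imp_bounded)
  then obtain r0 where "0 < r0" "convex hull V \<subseteq> ball 0 r0"
    using bounded_subset_ballD[of "convex hull V" 0] by blast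
  then have "r0 \<in> ?R"
    using ball_subset_cball[of 0 r0] by (auto intro!: exI[of _ 0])
  then have "?R \<noteq> {}" by blast
  \<comment> \<open>\<open>ball_size\<close> is twice an infimum; the strict inequality yields an
    actual enclosing ball.\<close>
  moreover have "Inf ?R < h / 2" using V(3) by (simp add: ball_size_def)
  ultimately obtain r where "r \<in> ?R" "r < h / 2"
    using cInf_lessD[of ?R "h / 2"] by blast
  then obtain c where c: "convex hull V \<subseteq> cball c r" "2 * r \<le> h" by auto
  obtain y where y: "y \<in> V" "v \<bullet> z \<le> v \<bullet> y"
    using convex_hull_support_point[OF V(4)] by blast
  have "y \<in> convex hull V" using y(1) hull_inc by fast
  then have "dist c y \<le> r" "dist c z \<le> r" using V(4) c(1) by auto
  then have "dist y z \<le> 2 * r" using dist_triangle3[of y z c] by linarith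
  then show ?thesis
    using y V(1) c(2) by (intro that[of y]) (auto simp: dist_norm)
qed

lemma inner_region_shift:
  assumes "x \<in> inner_region r P" "0 < r" "norm v \<le> r / 2"
  shows "x + v \<in> open_conv P"
  unfolding open_conv_def mem_interior
proof (intro exI conjI)
  show "ball (x + v) (r / 2) \<subseteq> closed_conv P"
  proof
    fix y assume "y \<in> ball (x + v) (r / 2)"
    then have "norm (x + v - y) < r / 2" by (simp add: dist_norm)
    moreover have "norm (x - y) \<le> norm (x + v - y) + norm v"
      using norm_triangle_ineq4[of "x + v - y" v] by simp
    ultimately have "y \<in> cball x r" using assms by (simp add: dist_norm)
    then show "y \<in> closed_conv P" using assms by (auto simp: inner_region_def)
  qed
qed (use assms in simp)

text \<open>The covering is used not at \<open>x\<close> but at \<open>x\<close> displaced by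
  \<open>\<epsilon> * h / 2\<close> in direction \<open>v\<close>, which stays in the open hull. The
  displacement is the source of the gain \<open>\<epsilon> * h / 2 * norm v\<close>.\<close>

lemma inner_region_node:
  fixes v :: "'a::euclidean_space"
  assumes "h_covering h (X ` I) (open_conv (X ` I))" "x \<in> inner_region (\<epsilon> * h) (X ` I)" "0 < \<epsilon>" "0 < h"
  obtains a where "a \<in> I" "norm (X a - x) \<le> (1 + \<epsilon>) * h" "\<epsilon> * h / 2 * norm v \<le> v \<bullet> (X a - x)"
proof -
  define z where "z = x + (\<epsilon> * h / 2) *\<^sub>R sgn v"
  have nz: "norm (z - x) \<le> \<epsilon> * h / 2"
    using assms by (simp add: z_def norm_sgn)
  have "z \<in> open_conv (X ` I)"
    unfolding z_def using assms by (intro inner_region_shift[of _ "\<epsilon> * h"]) (auto simp: norm_sgn)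
  then obtain a where a: "a \<in> I" "norm (X a - z) \<le> h" "v \<bullet> z \<le> v \<bullet> X a"
    using h_covering_node[OF assms(1)] by (metis imageE)
  have "norm (X a - x) \<le> norm (X a - z) + norm (z - x)"
    using norm_triangle_ineq[of "X a - z" "z - x"] by simp
  also have "\<dots> \<le> h + \<epsilon> * h"
    using a(2) nz mult_pos_pos[OF assms(3,4)] by linarith
  finally have "norm (X a - x) \<le> (1 + \<epsilon>) * h" by (simp add: algebra_simps)
  moreover have "v \<bullet> sgn v = norm v"
    by (cases "v = 0") (simp_all add: sgn_div_norm dot_square_norm power2_eq_square)
  then have "\<epsilon> * h / 2 * norm v \<le> v \<bullet> (X a - x)"
    using a(3) by (simp add: z_def inner_add_right inner_diff_right)
  ultimately show ?thesis by (intro that[OF a(1)])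
qed

text \<open>Completing the square; the Gaussian factor can thus absorb any exponential
  growth.\<close>

lemma exp_quadratic_le:
  fixes \<gamma> B t :: real
  assumes "0 < \<gamma>"
  shows "exp (- \<gamma> * t\<^sup>2 + B * t) \<le> exp (B\<^sup>2 / (4 * \<gamma>))"
proof -
  have "0 \<le> (2 * \<gamma> * t - B)\<^sup>2 / (4 * \<gamma>)" using assms by simp
  also have "\<dots> = \<gamma> * t\<^sup>2 - B * t + B\<^sup>2 / (4 * \<gamma>)"
    using assms by (simp add: power2_eq_square field_simps)
  finally show ?thesis by simp
qed

text \<open>The order of quantifiers is the point: \<open>c\<close> and \<open>M\<close> are fixed
  before the nodes, \<open>h\<close> and \<open>x\<close>, so they depend only on
  \<open>\<gamma>\<close>, \<open>\<tau>\<close>, \<open>\<epsilon>\<close> and the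
  dimension.\<close>

lemma gaussian_weights_moment_bounds:
  fixes \<gamma> \<tau> \<epsilon> :: real
  assumes \<gamma>: "0 < \<gamma>" and \<epsilon>: "0 < \<epsilon>"
  shows "\<exists>c>0. \<exists>M. (\<forall>k. 0 \<le> M k) \<and> (\<forall>(I :: nat set) (X :: nat \<Rightarrow> real^'n::finite) h x \<theta> q.
     finite I \<longrightarrow> inj_on X I \<longrightarrow> 0 < h \<longrightarrow> h_covering h (X ` I) (open_conv (X ` I)) \<longrightarrow>
     h_density_bounded h \<tau> (X ` I) \<longrightarrow> x \<in> inner_region (\<epsilon> * h) (X ` I) \<longrightarrow>
     (\<forall>a\<in>I. q a = exp (- (\<gamma> / h\<^sup>2) * (norm (X a - x))\<^sup>2 + \<theta> \<bullet> (X a - x)) /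
        (\<Sum>b\<in>I. exp (- (\<gamma> / h\<^sup>2) * (norm (X b - x))\<^sup>2 + \<theta> \<bullet> (X b - x)))) \<longrightarrow>
     (\<Sum>a\<in>I. q a *\<^sub>R (X a - x)) = 0 \<longrightarrow>
     (\<forall>k. (\<Sum>a\<in>I. q a * norm (X a - x) ^ k) \<le> M k * h ^ k) \<and>
     (\<forall>v. c * h\<^sup>2 * (norm v)\<^sup>2 \<le> (\<Sum>a\<in>I. q a * (v \<bullet> (X a - x))\<^sup>2)))"
proof -
  obtain S where S: "1 \<le> S" and Sbound: "\<And>(I :: nat set) (X :: nat \<Rightarrow> real^'n) h x.
    finite I \<Longrightarrow> inj_on X I \<Longrightarrow> 0 < h \<Longrightarrow> h_density_bounded h \<tau> (X ` I) \<Longrightarrow>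
    (\<Sum>a\<in>I. exp (- (norm (X a - x) / h))) \<le> S"
    using exp_minus_dist_sum_bounded[of \<tau>] by blast
  \<comment> \<open>Will bound the partition function from above: the Gaussian gives up a factor
    \<open>exp (- \<rho> a)\<close>, whose sum is at most \<open>S\<close>.\<close>
  define S0 where "S0 = exp (1 / (4 * \<gamma>)) * S"
  have S0: "1 \<le> S0" using S \<gamma> mult_mono[of 1 "exp (1 / (4 * \<gamma>))" 1 S] by (simp add: S0_def)
  \<comment> \<open>The largest Gaussian exponent at nodes within
    \<open>(1 + \<epsilon>) * h\<close> of \<open>x\<close>.\<close>
  define R where "R = \<gamma> * (1 + \<epsilon>)\<^sup>2"
  have R0: "0 \<le> R" using \<gamma> by (simp add: R_def)
  \<comment> \<open>The bound on \<open>h * norm \<theta>\<close> obtained by solving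
    \<open>- R + \<epsilon> * h / 2 * norm \<theta> \<le> ln S0\<close>.\<close>
  define L where "L = 2 / \<epsilon> * (ln S0 + R)"
  have L0: "0 \<le> L" using \<epsilon> S0 R0 by (simp add: L_def)
  \<comment> \<open>A single node suffices: the quotient bounds its weight from below, and
    \<open>\<epsilon> / 2\<close> comes from \<open>inner_region_node\<close>.\<close>
  define c where "c = exp (- R - L * (1 + \<epsilon>)) / S0 * (\<epsilon> / 2)\<^sup>2"
  \<comment> \<open>\<open>exp R\<close> bounds \<open>1 / Z\<close>. In the exponent,
    \<open>L\<close> pays for \<open>\<theta>\<close>, \<open>k\<close> for the power of
    \<open>\<rho> a\<close>, and 1 for the factor \<open>exp (- \<rho> a)\<close> kept for the
    density sum.\<close>
  define M where "M k = exp R * (exp ((L + real k + 1)\<^sup>2 / (4 * \<gamma>)) * S)" for k :: nat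
  have c0: "0 < c" using S0 \<epsilon> by (simp add: c_def)
  have M0: "0 \<le> M k" for k using S by (simp add: M_def)
  have main: "(\<forall>k. (\<Sum>a\<in>I. q a * norm (X a - x) ^ k) \<le> M k * h ^ k) \<and>
     (\<forall>v. c * h\<^sup>2 * (norm v)\<^sup>2 \<le> (\<Sum>a\<in>I. q a * (v \<bullet> (X a - x))\<^sup>2))"
    if I: "finite I" and inj: "inj_on X I" and h: "0 < h"
      and cov: "h_covering h (X ` I) (open_conv (X ` I))"
      and dens: "h_density_bounded h \<tau> (X ` I)" and x: "x \<in> inner_region (\<epsilon> * h) (X ` I)"
      and q: "\<forall>a\<in>I. q a = exp (- (\<gamma> / h\<^sup>2) * (norm (X a - x))\<^sup>2 + \<theta> \<bullet> (X a - x)) /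
        (\<Sum>b\<in>I. exp (- (\<gamma> / h\<^sup>2) * (norm (X b - x))\<^sup>2 + \<theta> \<bullet> (X b - x)))"
      and centred: "(\<Sum>a\<in>I. q a *\<^sub>R (X a - x)) = 0"
    for I :: "nat set" and X :: "nat \<Rightarrow> real^'n" and h x \<theta> q
  proof -
    define \<rho> where "\<rho> a = norm (X a - x) / h" for a
    define E where "E a = exp (- \<gamma> * (\<rho> a)\<^sup>2 + \<theta> \<bullet> (X a - x))" for a
    define Z where "Z = (\<Sum>a\<in>I. E a)"
    have \<rho>0: "0 \<le> \<rho> a" for a using h by (simp add: \<rho>_def)
    have E0: "0 < E a" for a by (simp add: E_def)
    have qE: "q a = E a / Z" if "a \<in> I" for a
      using q that by (simp add: E_def Z_def \<rho>_def power_divide)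
    note node = inner_region_node[OF cov x \<epsilon> h]
    obtain a0 where a0: "a0 \<in> I" "norm (X a0 - x) \<le> (1 + \<epsilon>) * h" "\<epsilon> * h / 2 * norm \<theta> \<le> \<theta> \<bullet> (X a0 - x)"
      using node by blast
    have near: "\<gamma> * (\<rho> a)\<^sup>2 \<le> R" if "norm (X a - x) \<le> (1 + \<epsilon>) * h" for a
    proof -
      have "\<rho> a \<le> 1 + \<epsilon>" using that h by (simp add: \<rho>_def pos_divide_le_eq)
      then show ?thesis
        unfolding R_def using \<gamma> \<rho>0 by (intro mult_left_mono power_mono) auto
    qed
    have EZ: "E a \<le> Z" if "a \<in> I" for a
      unfolding Z_def by (rule member_le_sum) (use that I E0 in \<open>auto intro: less_imp_le\<close>)
    have Z0: "0 < Z" using EZ[OF a0(1)] E0[of a0] by linarith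
    have q0: "0 \<le> q a" if "a \<in> I" for a
      unfolding qE[OF that] using E0[of a] Z0 by simp
    have E_sum: "(\<Sum>a\<in>I. E a *\<^sub>R (X a - x)) = 0"
    proof -
      have "(\<Sum>a\<in>I. E a *\<^sub>R (X a - x)) = Z *\<^sub>R (\<Sum>a\<in>I. q a *\<^sub>R (X a - x))"
        using Z0 by (simp add: scaleR_sum_right qE)
      then show ?thesis using centred by simp
    qed

    \<comment> \<open>Centring allows subtracting a term that vanishes; then
      \<open>1 - s \<le> exp (- s)\<close> cancels \<open>\<theta>\<close> from every summand and
      leaves the partition function at parameter 0.\<close>
    have "Z = (\<Sum>a\<in>I. E a) - \<theta> \<bullet> (\<Sum>a\<in>I. E a *\<^sub>R (X a - x))"
      unfolding E_sum Z_def by simp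
    also have "\<dots> = (\<Sum>a\<in>I. E a * (1 - \<theta> \<bullet> (X a - x)))"
      by (simp add: inner_sum_right right_diff_distrib sum_subtractf)
    also have "\<dots> \<le> (\<Sum>a\<in>I. exp (1 / (4 * \<gamma>)) * exp (- \<rho> a))"
    proof (rule sum_mono)
      fix a
      have "E a * (1 - \<theta> \<bullet> (X a - x)) \<le> E a * exp (- (\<theta> \<bullet> (X a - x)))"
        using exp_ge_add_one_self[of "- (\<theta> \<bullet> (X a - x))"] E0[of a] by (intro mult_left_mono) auto
      also have "\<dots> = exp (- \<gamma> * (\<rho> a)\<^sup>2 + 1 * \<rho> a) * exp (- \<rho> a)"
        by (simp add: E_def flip: exp_add)
      also have "\<dots> \<le> exp (1 / (4 * \<gamma>)) * exp (- \<rho> a)"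
        using exp_quadratic_le[OF \<gamma>, of "\<rho> a" 1] by (intro mult_right_mono) auto
      finally show "E a * (1 - \<theta> \<bullet> (X a - x)) \<le> exp (1 / (4 * \<gamma>)) * exp (- \<rho> a)" .
    qed
    also have "\<dots> \<le> S0"
      using Sbound[OF I inj h dens, of x] by (simp add: S0_def \<rho>_def flip: sum_distrib_left)
    finally have Z_le: "Z \<le> S0" .

    have "exp (- R + \<epsilon> * h / 2 * norm \<theta>) \<le> E a0"
      using near[OF a0(2)] a0(3) by (simp add: E_def)
    then have Z_ge: "exp (- R + \<epsilon> * h / 2 * norm \<theta>) \<le> Z"
      using EZ[OF a0(1)] by linarith
    then have "exp (- R + \<epsilon> * h / 2 * norm \<theta>) \<le> S0" using Z_le by linarith
    then have "- R + \<epsilon> * h / 2 * norm \<theta> \<le> ln S0"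
      using S0 by (simp add: ln_ge_iff)
    then have \<theta>L: "h * norm \<theta> \<le> L"
      using \<epsilon> by (simp add: L_def field_simps)
    have inner_le: "\<bar>\<theta> \<bullet> (X a - x)\<bar> \<le> L * \<rho> a" for a
    proof -
      have "\<bar>\<theta> \<bullet> (X a - x)\<bar> \<le> norm \<theta> * norm (X a - x)" by (rule Cauchy_Schwarz_ineq2)
      also have "\<dots> = (h * norm \<theta>) * \<rho> a" using h by (simp add: \<rho>_def)
      also have "\<dots> \<le> L * \<rho> a" using \<theta>L \<rho>0 by (intro mult_right_mono) auto
      finally show ?thesis .
    qed
    have "exp (- R) \<le> exp (- R + \<epsilon> * h / 2 * norm \<theta>)"
      using \<epsilon> h by simp
    then have Z_ge': "exp (- R) \<le> Z" using Z_ge by linarith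

    have "(\<Sum>a\<in>I. q a * norm (X a - x) ^ k) \<le> M k * h ^ k" for k
    proof -
      have "q a * \<rho> a ^ k \<le> exp R * (exp ((L + real k + 1)\<^sup>2 / (4 * \<gamma>)) * exp (- \<rho> a))" if "a \<in> I" for a
      proof -
        have "\<rho> a \<le> exp (\<rho> a)"
          using exp_ge_add_one_self[of "\<rho> a"] by linarith
        then have "\<rho> a ^ k \<le> exp (\<rho> a) ^ k"
          using \<rho>0 by (intro power_mono) auto
        also have "\<dots> = exp (real k * \<rho> a)" by (simp add: exp_of_nat_mult)
        finally have "E a * \<rho> a ^ k \<le> exp (- \<gamma> * (\<rho> a)\<^sup>2 + L * \<rho> a) * exp (real k * \<rho> a)"
          using inner_le[of a] \<rho>0 by (intro mult_mono) (auto simp: E_def abs_le_iff)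
        also have "\<dots> = exp (- \<gamma> * (\<rho> a)\<^sup>2 + (L + real k + 1) * \<rho> a) * exp (- \<rho> a)"
          by (simp add: algebra_simps flip: exp_add)
        also have "\<dots> \<le> exp ((L + real k + 1)\<^sup>2 / (4 * \<gamma>)) * exp (- \<rho> a)"
          using exp_quadratic_le[OF \<gamma>] by (intro mult_right_mono) auto
        finally have Ea: "E a * \<rho> a ^ k \<le> exp ((L + real k + 1)\<^sup>2 / (4 * \<gamma>)) * exp (- \<rho> a)" .
        have "1 \<le> exp R * Z"
          using mult_left_mono[OF Z_ge', of "exp R"] by (simp flip: exp_add)
        then have "1 / Z \<le> exp R" using Z0 by (simp add: pos_divide_le_eq)
        then have "1 / Z * (E a * \<rho> a ^ k) \<le> exp R * (exp ((L + real k + 1)\<^sup>2 / (4 * \<gamma>)) * exp (- \<rho> a))"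
          using E0[of a] \<rho>0[of a] by (intro mult_mono[OF _ Ea]) auto
        then show ?thesis using qE[OF that] by simp
      qed
      then have "(\<Sum>a\<in>I. q a * \<rho> a ^ k) \<le> (\<Sum>a\<in>I. exp R * (exp ((L + real k + 1)\<^sup>2 / (4 * \<gamma>)) * exp (- \<rho> a)))"
        by (rule sum_mono)
      also have "\<dots> = exp R * (exp ((L + real k + 1)\<^sup>2 / (4 * \<gamma>)) * (\<Sum>a\<in>I. exp (- \<rho> a)))"
        by (simp add: sum_distrib_left)
      also have "\<dots> \<le> M k"
        unfolding M_def using Sbound[OF I inj h dens, of x] by (intro mult_left_mono) (auto simp: \<rho>_def)
      finally have "(\<Sum>a\<in>I. q a * \<rho> a ^ k) * h ^ k \<le> M k * h ^ k"
        using h by (intro mult_right_mono) auto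
      then show ?thesis
        using h by (simp add: sum_distrib_right \<rho>_def power_divide)
    qed
    moreover have "c * h\<^sup>2 * (norm v)\<^sup>2 \<le> (\<Sum>a\<in>I. q a * (v \<bullet> (X a - x))\<^sup>2)" for v
    proof -
      obtain a where a: "a \<in> I" "norm (X a - x) \<le> (1 + \<epsilon>) * h" "\<epsilon> * h / 2 * norm v \<le> v \<bullet> (X a - x)"
        using node by blast
      have "\<rho> a \<le> 1 + \<epsilon>" using a(2) h by (simp add: \<rho>_def pos_divide_le_eq)
      then have "L * \<rho> a \<le> L * (1 + \<epsilon>)" using L0 by (intro mult_left_mono)
      then have "exp (- R - L * (1 + \<epsilon>)) \<le> E a"
        using near[OF a(2)] inner_le[of a] by (simp add: E_def)
      then have qa: "exp (- R - L * (1 + \<epsilon>)) / S0 \<le> q a"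
        unfolding qE[OF a(1)] using Z_le Z0 E0[of a] by (intro frac_le) auto
      have "c * h\<^sup>2 * (norm v)\<^sup>2 = exp (- R - L * (1 + \<epsilon>)) / S0 * (\<epsilon> * h / 2 * norm v)\<^sup>2"
        by (simp add: c_def power_mult_distrib power_divide)
      also have "\<dots> \<le> q a * (v \<bullet> (X a - x))\<^sup>2"
        using qa a(3) \<epsilon> h S0 E0[of a] Z0 qE[OF a(1)] by (intro mult_mono power_mono) auto
      also have "\<dots> \<le> (\<Sum>a\<in>I. q a * (v \<bullet> (X a - x))\<^sup>2)"
        by (rule member_le_sum) (use a(1) I q0 in auto)
      finally show ?thesis .
    qed
    ultimately show ?thesis by blast
  qed
  show ?thesis
    by (rule exI[of _ c], rule conjI[OF c0], rule exI[of _ M], rule conjI, rule allI, rule M0,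
        (rule allI)+, (rule impI)+, rule main, assumption+)
qed

section \<open>The error estimate\<close>

lemma has_derivative_imp_partial_deriv:
  fixes f :: "real^'n::finite \<Rightarrow> real"
  assumes "(f has_derivative f') (at x)"
  shows "partial_deriv i f x = f' (axis i 1)"
proof -
  have "((\<lambda>t. x + t *\<^sub>R axis i 1) has_derivative (\<lambda>t. t *\<^sub>R axis i 1)) (at 0)"
    by (auto intro!: derivative_eq_intros)
  moreover have "(f has_derivative f') (at (x + 0 *\<^sub>R axis i 1))"
    using assms by simp
  ultimately have "((\<lambda>t. f (x + t *\<^sub>R axis i 1)) has_derivative (\<lambda>t. f' (t *\<^sub>R axis i 1))) (at 0)"
    by (rule has_derivative_compose)
  moreover have "f' (t *\<^sub>R axis i 1) = f' (axis i 1) * t" for t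
    using linear_cmul[OF has_derivative_linear[OF assms]] by simp
  ultimately have "((\<lambda>t. f (x + t *\<^sub>R axis i 1)) has_real_derivative f' (axis i 1)) (at 0)"
    by (simp add: has_field_derivative_def)
  then show ?thesis
    unfolding partial_deriv_def by (rule DERIV_imp_deriv)
qed

lemma mi_order_le_1_cases:
  assumes "mi_order \<alpha> \<le> 1"
  obtains "\<alpha> = (\<lambda>_. 0)" | i where "\<alpha> = (\<lambda>j. if j = i then 1 else 0)"
proof (cases "mi_order \<alpha> = 0")
  case True
  then have "\<alpha> = (\<lambda>_. 0)" by (auto simp: mi_order_def)
  then show ?thesis by (rule that)
next
  case False
  then have "mi_order \<alpha> = 1" using assms by linarith
  then have "(\<Sum>i\<in>UNIV. \<alpha> i) = 1" by (simp add: mi_order_def)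
  then obtain i where "\<alpha> i = 1" "\<And>j. i \<noteq> j \<Longrightarrow> \<alpha> j = 0"
    using sum_eq_1_iff[of UNIV \<alpha>] by auto
  then have "\<alpha> = (\<lambda>j. if j = i then 1 else 0)" by auto
  then show ?thesis by (rule that)
qed

text \<open>By convexity the segment from the interior point \<open>x\<close> to a node stays in the
  interior, except possibly at the node.\<close>

lemma node_taylor_bound:
  fixes X :: "'i \<Rightarrow> real^'n::finite"
  assumes "finite I" "C_closure 2 (open_conv (X ` I)) u" "x \<in> open_conv (X ` I)" "a \<in> I"
  shows "\<bar>u (X a) - u x - (\<Sum>i\<in>UNIV. (X a - x) $ i * partial_deriv i u x)\<bar>
           \<le> (CARD('n))\<^sup>2 * D2_norm (open_conv (X ` I)) u * (norm (X a - x))\<^sup>2"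
proof -
  let ?K = "convex hull (X ` I)" and ?\<Omega> = "open_conv (X ` I)"
  have \<Omega>: "?\<Omega> = interior ?K"
    using assms(1) by (simp add: open_conv_def closed_conv_finite)
  then have ne: "interior ?K \<noteq> {}" using assms(3) by auto
  have op: "open ?\<Omega>" by (simp add: \<Omega>)
  have "compact ?K" using assms(1) by (simp add: finite_imp_compact_convex_hull)
  then have bd: "bounded ?\<Omega>"
    unfolding \<Omega> using bounded_subset[OF compact_imp_bounded interior_subset] by blast
  have Xa: "X a \<in> closure ?K"
    using assms(4) closure_subset[of ?K] hull_subset[of "X ` I" convex] by blast
  have ext: "derivs_extend 2 ?\<Omega> u" and cont: "continuous_on (closure ?\<Omega>) u"
    using assms(2) by (auto simp: C_closure_def)
  show ?thesis
  proof (rule taylor_second_order_bound[OF op assms(3) _ _ cont])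
    show "open_segment x (X a) \<subseteq> ?\<Omega>"
      using in_interior_closure_convex_segment[OF convex_convex_hull _ Xa] assms(3) by (simp add: \<Omega>)
    show "X a \<in> closure ?\<Omega>"
      using Xa convex_closure_interior[OF convex_convex_hull ne] by (simp add: \<Omega>)
    show "\<bar>partial_deriv j (partial_deriv i u) y\<bar> \<le> D2_norm ?\<Omega> u" if "y \<in> ?\<Omega>" for i j y
      by (rule second_partial_le_D2_norm[OF op bd assms(2) that])
  qed (use derivs_extend_2D[OF ext] in auto)
qed

lemma abs_weighted_sum_le:
  fixes f g e :: "'i \<Rightarrow> real"
  assumes "\<And>a. a \<in> I \<Longrightarrow> \<bar>f a\<bar> \<le> g a" "\<And>a. a \<in> I \<Longrightarrow> \<bar>e a\<bar> \<le> K * r a"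
  shows "\<bar>\<Sum>a\<in>I. f a * e a\<bar> \<le> K * (\<Sum>a\<in>I. g a * r a)"
proof -
  have "\<bar>\<Sum>a\<in>I. f a * e a\<bar> \<le> (\<Sum>a\<in>I. \<bar>f a * e a\<bar>)" by (rule sum_abs)
  also have "\<dots> \<le> (\<Sum>a\<in>I. g a * (K * r a))"
  proof (rule sum_mono)
    fix a assume a: "a \<in> I"
    have "\<bar>f a\<bar> * \<bar>e a\<bar> \<le> g a * (K * r a)"
      using assms(1)[OF a] by (intro mult_mono[OF assms(1)[OF a] assms(2)[OF a]]) auto
    then show "\<bar>f a * e a\<bar> \<le> g a * (K * r a)" by (simp add: abs_mult)
  qed
  also have "\<dots> = K * (\<Sum>a\<in>I. g a * r a)" by (simp add: sum_distrib_left mult_ac)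
  finally show ?thesis .
qed

theorem theorem2:
  fixes \<gamma> \<tau> \<epsilon> :: real
  assumes "\<gamma> > 0" and "\<tau> > 0" and "\<epsilon> > 0"
  shows "\<exists>C>0. \<forall>(I :: nat set) (X :: nat \<Rightarrow> real^'n::finite) (h :: real)
            (w :: nat \<Rightarrow> real^'n \<Rightarrow> real) (u :: real^'n \<Rightarrow> real).
      finite I \<longrightarrow> inj_on X I \<longrightarrow> h > 0 \<longrightarrow>
      h_covering h (X ` I) (open_conv (X ` I)) \<longrightarrow>
      h_density_bounded h \<tau> (X ` I) \<longrightarrow>
      lme_scheme I X (\<gamma> / h\<^sup>2) w \<longrightarrow>
      C_closure 2 (open_conv (X ` I)) u \<longrightarrow>
      (\<forall>x\<in>inner_region (\<epsilon> * h) (X ` I). \<forall>\<alpha>. mi_order \<alpha> \<le> 1 \<longrightarrow>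
         \<bar>mi_deriv \<alpha> (approximant I X w u) x - mi_deriv \<alpha> u x\<bar>
           \<le> C * D2_norm (open_conv (X ` I)) u * h ^ (2 - mi_order \<alpha>))"
proof -
  obtain c M where c: "0 < c" and M: "\<forall>k. 0 \<le> M k"
    and moments: "\<forall>(I :: nat set) (X :: nat \<Rightarrow> real^'n) h x \<theta> q.
     finite I \<longrightarrow> inj_on X I \<longrightarrow> 0 < h \<longrightarrow> h_covering h (X ` I) (open_conv (X ` I)) \<longrightarrow>
     h_density_bounded h \<tau> (X ` I) \<longrightarrow> x \<in> inner_region (\<epsilon> * h) (X ` I) \<longrightarrow>
     (\<forall>a\<in>I. q a = exp (- (\<gamma> / h\<^sup>2) * (norm (X a - x))\<^sup>2 + \<theta> \<bullet> (X a - x)) /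
        (\<Sum>b\<in>I. exp (- (\<gamma> / h\<^sup>2) * (norm (X b - x))\<^sup>2 + \<theta> \<bullet> (X b - x)))) \<longrightarrow>
     (\<Sum>a\<in>I. q a *\<^sub>R (X a - x)) = 0 \<longrightarrow>
     (\<forall>k. (\<Sum>a\<in>I. q a * norm (X a - x) ^ k) \<le> M k * h ^ k) \<and>
     (\<forall>v. c * h\<^sup>2 * (norm v)\<^sup>2 \<le> (\<Sum>a\<in>I. q a * (v \<bullet> (X a - x))\<^sup>2))"
    using gaussian_weights_moment_bounds[OF assms(1,3), of \<tau>, where 'n = 'n] by (elim exE conjE) (rule that)
  define N where "N = (real CARD('n))\<^sup>2"
  \<comment> \<open>The terms serve the errors of the value (second moment) and of the gradient
    (third moment over the lower bound for \<open>J\<close>); the 1 makes \<open>C\<close>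
    positive.\<close>
  define C where "C = N * M 2 + N * (M 3 / c) + 1"
  have N: "0 \<le> N" by (simp add: N_def)
  have C: "N * M 2 \<le> C" "N * (M 3 / c) \<le> C" "0 < C"
    using N M c by (auto simp: C_def intro!: add_nonneg_nonneg add_nonneg_pos)
  have main: "\<bar>mi_deriv \<alpha> (approximant I X w u) x - mi_deriv \<alpha> u x\<bar>
           \<le> C * D2_norm (open_conv (X ` I)) u * h ^ (2 - mi_order \<alpha>)"
    if I: "finite I" and inj: "inj_on X I" and h: "0 < h"
      and cov: "h_covering h (X ` I) (open_conv (X ` I))"
      and dens: "h_density_bounded h \<tau> (X ` I)"
      and lme: "lme_scheme I X (\<gamma> / h\<^sup>2) w"
      and u: "C_closure 2 (open_conv (X ` I)) u"
      and x: "x \<in> inner_region (\<epsilon> * h) (X ` I)" and \<alpha>: "mi_order \<alpha> \<le> 1"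
    for I :: "nat set" and X :: "nat \<Rightarrow> real^'n" and h w u x \<alpha>
  proof -
    define D where "D = D2_norm (open_conv (X ` I)) u"
    define r where "r a = X a - x" for a
    define l where "l v = (\<Sum>i\<in>UNIV. v $ i * partial_deriv i u x)" for v
    define e where "e a = u (X a) - u x - l (r a)" for a
    have lin: "linear l"
      unfolding l_def[abs_def]
      by (rule linearI) (simp_all add: distrib_right sum.distrib sum_distrib_left mult.assoc)
    have x\<Omega>: "x \<in> open_conv (X ` I)"
      using inner_region_shift[OF x, of 0] assms h by simp
    have D0: "0 \<le> D"
    proof -
      have "open (open_conv (X ` I))" "bounded (open_conv (X ` I))"
        using I bounded_subset[OF compact_imp_bounded[OF finite_imp_compact_convex_hull] interior_subset]
        by (auto simp: open_conv_def closed_conv_finite)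
      \<comment> \<open>Any coordinate will do: \<open>D\<close> bounds an absolute value.\<close>
      then have "\<bar>partial_deriv undefined (partial_deriv undefined u) x\<bar> \<le> D"
        unfolding D_def using u x\<Omega> by (rule second_partial_le_D2_norm)
      then show ?thesis by linarith
    qed
    have taylor: "\<bar>e a\<bar> \<le> N * D * (norm (r a))\<^sup>2" if "a \<in> I" for a
      using node_taylor_bound[OF I u x\<Omega> that] by (simp add: e_def l_def r_def N_def D_def)
    have "0 < \<gamma> / h\<^sup>2" using assms h by simp
    from lme_scheme_gibbs_form[OF I this lme x\<Omega>]
    obtain \<theta> G where
      weights: "\<forall>a\<in>I. w a x = exp (- (\<gamma> / h\<^sup>2) * (norm (X a - x))\<^sup>2 + \<theta> \<bullet> (X a - x)) /
        (\<Sum>b\<in>I. exp (- (\<gamma> / h\<^sup>2) * (norm (X b - x))\<^sup>2 + \<theta> \<bullet> (X b - x)))"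
      and G: "\<forall>v. (\<Sum>a\<in>I. (w a x * (G v \<bullet> (X a - x))) *\<^sub>R (X a - x)) = v"
      and dw: "\<forall>a\<in>I. (w a has_derivative (\<lambda>v. w a x * (G v \<bullet> (X a - x)))) (at x)"
      by (elim exE conjE) (rule that)
    have "x \<in> closed_conv (X ` I)"
      using x\<Omega> interior_subset by (auto simp: open_conv_def)
    then have feas: "lme_feasible I X x (\<lambda>a. w a x)"
      using lme by (auto simp: lme_scheme_def is_arg_min_def)
    have w0: "0 \<le> w a x" if "a \<in> I" for a
      using feas that by (auto simp: lme_feasible_def)
    have w1: "(\<Sum>a\<in>I. w a x) = 1"
      using feas by (auto simp: lme_feasible_def)
    have wr: "(\<Sum>a\<in>I. w a x *\<^sub>R r a) = 0"
      using feas by (simp add: lme_feasible_def r_def scaleR_diff_right sum_subtractf flip: scaleR_left.sum)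
    have "(\<forall>k. (\<Sum>a\<in>I. w a x * norm (X a - x) ^ k) \<le> M k * h ^ k) \<and>
        (\<forall>v. c * h\<^sup>2 * (norm v)\<^sup>2 \<le> (\<Sum>a\<in>I. w a x * (v \<bullet> (X a - x))\<^sup>2))"
      by (rule moments[THEN spec, THEN spec, THEN spec, THEN spec, THEN spec, THEN spec,
            THEN mp, THEN mp, THEN mp, THEN mp, THEN mp, THEN mp, THEN mp, THEN mp,
            OF I inj h cov dens x weights]) (use wr in \<open>simp add: r_def\<close>)
    then have mom: "(\<Sum>a\<in>I. w a x * norm (r a) ^ k) \<le> M k * h ^ k"
      and coercive: "c * h\<^sup>2 * (norm v)\<^sup>2 \<le> (\<Sum>a\<in>I. w a x * (v \<bullet> r a)\<^sup>2)" for k v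
      unfolding r_def by blast+
    from \<alpha> show ?thesis
    proof (cases rule: mi_order_le_1_cases)
      case 1
      have "(\<Sum>a\<in>I. w a x * l (r a)) = l (\<Sum>a\<in>I. w a x *\<^sub>R r a)"
        by (simp add: linear_sum[OF lin] linear_cmul[OF lin])
      then have "(\<Sum>a\<in>I. w a x * l (r a)) = 0"
        by (simp add: wr linear_0[OF lin])
      then have "approximant I X w u x - u x = (\<Sum>a\<in>I. w a x * e a)"
        using w1 by (simp add: approximant_def e_def right_diff_distrib sum_subtractf mult.commute
            flip: sum_distrib_left sum_distrib_right)
      also have "\<bar>\<dots>\<bar> \<le> N * D * (\<Sum>a\<in>I. w a x * (norm (r a))\<^sup>2)"
        by (rule abs_weighted_sum_le) (use w0 taylor in auto)
      also have "\<dots> \<le> N * D * (M 2 * h\<^sup>2)"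
        using N D0 mom by (intro mult_left_mono) auto
      also have "\<dots> = N * M 2 * (D * h\<^sup>2)" by simp
      also have "\<dots> \<le> C * (D * h\<^sup>2)"
        using C(1) D0 by (intro mult_right_mono) auto
      finally show ?thesis
        by (simp add: 1 mi_deriv_zero mi_order_def D_def)
    next
      case (2 i)
      define v :: "real^'n" where "v = axis i 1"
      define g where "g = G v"
      \<comment> \<open>Here \<open>g\<close> is \<open>J\<close> inverse applied to the unit vector
        \<open>v\<close>; testing the lower bound for \<open>J\<close> with \<open>g\<close> itself
        bounds its norm.\<close>
      have g: "c * h\<^sup>2 * norm g \<le> 1"
      proof (cases "g = 0")
        case False
        have "c * h\<^sup>2 * (norm g)\<^sup>2 \<le> (\<Sum>a\<in>I. w a x * (g \<bullet> r a)\<^sup>2)"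
          by (rule coercive)
        also have "\<dots> = g \<bullet> (\<Sum>a\<in>I. (w a x * (g \<bullet> r a)) *\<^sub>R r a)"
          by (simp add: inner_sum_right power2_eq_square mult.assoc)
        also have "\<dots> = g \<bullet> v" using G[rule_format, of v] by (simp add: g_def r_def)
        also have "\<dots> \<le> norm g * norm v" by (rule norm_cauchy_schwarz)
        also have "\<dots> = norm g" by (simp add: v_def norm_axis_1)
        finally show ?thesis using False by (simp add: power2_eq_square)
      qed simp
      have g': "norm g \<le> 1 / (c * h\<^sup>2)"
        using g c h by (simp add: pos_le_divide_eq mult.commute)
      have "(approximant I X w u has_derivative (\<lambda>v. \<Sum>a\<in>I. u (X a) * (w a x * (G v \<bullet> r a)))) (at x)"
        unfolding approximant_def[abs_def] r_def
        by (intro has_derivative_sum has_derivative_mult_right dw[rule_format])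
      from has_derivative_imp_partial_deriv[OF this, of i]
      have pd: "partial_deriv i (approximant I X w u) x = (\<Sum>a\<in>I. u (X a) * (w a x * (g \<bullet> r a)))"
        by (simp add: g_def v_def)
      \<comment> \<open>By linearity the first-order part sums to \<open>l\<close> applied to
        \<open>J g = v\<close>, so its derivative is reproduced exactly.\<close>
      have "(\<Sum>a\<in>I. (w a x * (g \<bullet> r a)) * l (r a)) = l (\<Sum>a\<in>I. (w a x * (g \<bullet> r a)) *\<^sub>R r a)"
        by (simp add: linear_sum[OF lin] linear_cmul[OF lin])
      also have "\<dots> = l v" using G[rule_format, of v] by (simp add: g_def r_def)
      also have "\<dots> = partial_deriv i u x"
        by (simp add: l_def v_def axis_def if_distrib[of "\<lambda>z. z * _"] cong: if_cong)
      finally have lr: "(\<Sum>a\<in>I. (w a x * (g \<bullet> r a)) * l (r a)) = partial_deriv i u x" .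
      have "(\<Sum>a\<in>I. w a x * (g \<bullet> r a)) = g \<bullet> (\<Sum>a\<in>I. w a x *\<^sub>R r a)"
        by (simp add: inner_sum_right)
      then have gr: "(\<Sum>a\<in>I. w a x * (g \<bullet> r a)) = 0" by (simp add: wr)
      have "(\<Sum>a\<in>I. (w a x * (g \<bullet> r a)) * e a) = (\<Sum>a\<in>I. (w a x * (g \<bullet> r a)) * u (X a))
          - (\<Sum>a\<in>I. w a x * (g \<bullet> r a)) * u x - (\<Sum>a\<in>I. (w a x * (g \<bullet> r a)) * l (r a))"
        by (simp only: e_def right_diff_distrib sum_subtractf sum_distrib_right)
      then have "partial_deriv i (approximant I X w u) x - partial_deriv i u x
          = (\<Sum>a\<in>I. (w a x * (g \<bullet> r a)) * e a)"
        unfolding pd lr gr by (simp add: mult.commute)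
      also have "\<bar>\<dots>\<bar> \<le> N * D * (\<Sum>a\<in>I. (w a x * (norm g * norm (r a))) * (norm (r a))\<^sup>2)"
      proof (rule abs_weighted_sum_le)
        fix a assume "a \<in> I"
        then show "\<bar>w a x * (g \<bullet> r a)\<bar> \<le> w a x * (norm g * norm (r a))"
          using w0 Cauchy_Schwarz_ineq2[of g "r a"] by (simp add: abs_mult mult_left_mono)
      qed (rule taylor)
      also have "\<dots> = N * D * (norm g * (\<Sum>a\<in>I. w a x * norm (r a) ^ 3))"
        by (simp add: sum_distrib_left power2_eq_square power3_eq_cube mult_ac)
      \<comment> \<open>The third moment is of order \<open>h ^ 3\<close> and \<open>norm g\<close>
        of order \<open>1 / h\<^sup>2\<close>, which leaves one power of \<open>h\<close>.\<close>
      also have "\<dots> \<le> N * D * (1 / (c * h\<^sup>2) * (M 3 * h ^ 3))"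
        using N D0 M c g' mom w0 by (intro mult_left_mono mult_mono sum_nonneg) auto
      also have "\<dots> = N * (M 3 / c) * (D * h)"
        using c h by (simp add: power2_eq_square power3_eq_cube)
      also have "\<dots> \<le> C * (D * h)"
        using C(2) D0 h by (intro mult_right_mono) auto
      finally show ?thesis
        by (simp add: 2 mi_deriv_unit mi_order_def D_def)
    qed
  qed
  show ?thesis
    by (rule exI[of _ C], intro conjI C(3) allI impI ballI, rule main)
qed

end
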